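(* Let $F$ be a field and let $q,n,e\in\mathbb{N}$ with $q>1$ and $e\mid q^n-1$, and put $m=m(q,e)$. If $e\le 32$, then $$\mathrm{LL}(A(q,n,e))=\left\lfloor n\frac{q-1}{m}\right\rfloor+1.$$
   Context: $\mathbb{N}$ denotes the set of positive integers, $\mathbb{N}_0=\mathbb{N}\cup\{0\}$. For $q,e\in\mathbb{N}$ with $\gcd(q,e)=1$, $m(q,e)$ is the smallest positive integer $t$ such that there exist $i_1,\dots,i_t\in\mathbb{N}_0$ (repetitions allowed) with $e\mid q^{i_1}+\dots+q^{i_t}$. For a field $F$ and $q,n,e\in\mathbb{N}$ with $q>1$ and $e\mid q^n-1$, let $I=(X_1^q,\dots,X_n^q)$ in the polynomial algebra $F[X_1,\dots,X_n]$ and $x_j=X_j+I$. Then $A(q,n,e)$ is the unital $F$-subalgebra of $F[x_1,\dots,x_n]=F[X_1,\dots,X_n]/I$ generated by all monomials $x_1^{i_1}\cdots x_n^{i_n}$ with $i_1+qi_2+\dots+q^{n-1}i_n\equiv 0\pmod e$. For a finite-dimensional algebra $A$ with Jacobson radical $\mathrm{J}(A)$, the Loewy length $\mathrm{LL}(A)$ is the smallest $l\in\mathbb{N}_0$ with $\mathrm{J}(A)^l=0$. *)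

theory Defs
  imports
    "HOL-Library.Poly_Mapping"
    "HOL-Number_Theory.Cong"
    "HOL-Algebra.QuotRing"
    "HOL-Algebra.Generated_Rings"
    "HOL-Algebra.Ideal_Product"
begin

definition m_number :: "nat \<Rightarrow> nat \<Rightarrow> nat" where
  "m_number q e = (LEAST t. t > 0 \<and> (\<exists>i :: nat \<Rightarrow> nat. e dvd (\<Sum>k = 1..t. q ^ i k)))"

section \<open>Jacobson radical and Loewy length\<close>

text \<open>For commutative rings (the only ones considered here) the Jacobson radical is the
  intersection of the maximal two-sided ideals. Ideal powers are taken in the
  multiplicative monoid of \<^const>\<open>ideals_set\<close>, so the zeroth power is the whole ring.\<close>

definition jacobson_radical :: "('a, 'b) ring_scheme \<Rightarrow> 'a set" where
  "jacobson_radical R = {x \<in> carrier R. \<forall>M. maximalideal M R \<longrightarrow> x \<in> M}"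

definition loewy_length :: "('a, 'b) ring_scheme \<Rightarrow> nat" where
  "loewy_length R = (LEAST l :: nat. jacobson_radical R [^]\<^bsub>ideals_set R\<^esub> l = {\<zero>\<^bsub>R\<^esub>})"

section \<open>Polynomials in $X_1, \dots, X_n$ and the truncated polynomial algebra\<close>

text \<open>A polynomial is a finitely supported map from exponent vectors to coefficients, and an
  exponent vector a finitely supported map from variable indices to exponents. The carrier
  consists of the polynomials in which only variables with index in \<open>{1..n}\<close> occur.\<close>

type_synonym 'f mpol = "(nat \<Rightarrow>\<^sub>0 nat) \<Rightarrow>\<^sub>0 'f"

definition mpoly_ring :: "'f::comm_ring_1 itself \<Rightarrow> nat \<Rightarrow> 'f mpol ring" where
  "mpoly_ring F n =
     \<lparr>carrier = {p. \<forall>a \<in> Poly_Mapping.keys p. Poly_Mapping.keys a \<subseteq> {1..n}},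
      mult = (*), one = 1, zero = 0, add = (+)\<rparr>"

definition mvar :: "nat \<Rightarrow> 'f::comm_ring_1 mpol" where
  "mvar j = Poly_Mapping.single (Poly_Mapping.single j 1) 1"

definition mconst :: "'f::comm_ring_1 \<Rightarrow> 'f mpol" where
  "mconst c = Poly_Mapping.single 0 c"

definition trunc_ideal :: "'f::comm_ring_1 itself \<Rightarrow> nat \<Rightarrow> nat \<Rightarrow> 'f mpol set" where
  "trunc_ideal F q n =
     genideal (mpoly_ring F n) {mvar j [^]\<^bsub>mpoly_ring F n\<^esub> q | j. j \<in> {1..n}}"

definition trunc_ring :: "'f::comm_ring_1 itself \<Rightarrow> nat \<Rightarrow> nat \<Rightarrow> 'f mpol set ring" where
  "trunc_ring F q n = mpoly_ring F n Quot trunc_ideal F q n"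

definition trunc_class ::
    "'f::comm_ring_1 itself \<Rightarrow> nat \<Rightarrow> nat \<Rightarrow> 'f mpol \<Rightarrow> 'f mpol set" where
  "trunc_class F q n p = trunc_ideal F q n +>\<^bsub>mpoly_ring F n\<^esub> p"

definition trunc_monom ::
    "'f::comm_ring_1 itself \<Rightarrow> nat \<Rightarrow> nat \<Rightarrow> (nat \<Rightarrow> nat) \<Rightarrow> 'f mpol set" where
  "trunc_monom F q n i =
     finprod (trunc_ring F q n)
       (\<lambda>j. trunc_class F q n (mvar j) [^]\<^bsub>trunc_ring F q n\<^esub> i j) {1..n}"

section \<open>The algebra $A(q,n,e)$\<close>

text \<open>The unital \<open>F\<close>-subalgebra generated by a set is the subring generated by that set
  together with the classes of the constants.\<close>

definition A_alg :: "'f::field itself \<Rightarrow> nat \<Rightarrow> nat \<Rightarrow> nat \<Rightarrow> 'f mpol set ring" where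
  "A_alg F q n e = (trunc_ring F q n)
     \<lparr>carrier := generate_ring (trunc_ring F q n)
        ({trunc_class F q n (mconst c) | c. True} \<union>
         {trunc_monom F q n i | i. [(\<Sum>j = 1..n. q ^ (j - 1) * i j) = 0] (mod e)})\<rparr>"

section \<open>These structures are commutative rings\<close>

lemma keys_add_nat:
  "Poly_Mapping.keys (a + b :: nat \<Rightarrow>\<^sub>0 nat) = Poly_Mapping.keys a \<union> Poly_Mapping.keys b"
  by (auto simp: Poly_Mapping.in_keys_iff Poly_Mapping.lookup_add)

lemma cring_mpoly_ring: "cring (mpoly_ring F n)"
proof (rule cringI)
  show "abelian_group (mpoly_ring F n)"
  proof (rule abelian_groupI)
    fix p assume p: "p \<in> carrier (mpoly_ring F n)"
    show "\<exists>r\<in>carrier (mpoly_ring F n). r \<oplus>\<^bsub>mpoly_ring F n\<^esub> p = \<zero>\<^bsub>mpoly_ring F n\<^esub>"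
      by (rule bexI[of _ "- p"]) (use p in \<open>auto simp: mpoly_ring_def\<close>)
  qed (use Poly_Mapping.keys_add in \<open>fastforce simp: mpoly_ring_def algebra_simps\<close>)+
  show "comm_monoid (mpoly_ring F n)"
  proof (rule comm_monoidI)
    fix p r assume "p \<in> carrier (mpoly_ring F n)" "r \<in> carrier (mpoly_ring F n)"
    then show "p \<otimes>\<^bsub>mpoly_ring F n\<^esub> r \<in> carrier (mpoly_ring F n)"
      using Poly_Mapping.keys_mult[of p r]
      by (fastforce simp: mpoly_ring_def keys_add_nat)
  qed (auto simp: mpoly_ring_def algebra_simps)
qed (auto simp: mpoly_ring_def algebra_simps)

lemma mvar_in_carrier: "j \<in> {1..n} \<Longrightarrow> mvar j \<in> carrier (mpoly_ring F n)"
  by (auto simp: mpoly_ring_def mvar_def)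

lemma mconst_in_carrier: "mconst c \<in> carrier (mpoly_ring F n)"
  by (auto simp: mpoly_ring_def mconst_def)

lemma ideal_trunc_ideal: "ideal (trunc_ideal F q n) (mpoly_ring F n)"
proof -
  interpret cring "mpoly_ring F n" by (rule cring_mpoly_ring)
  show ?thesis
    unfolding trunc_ideal_def by (rule genideal_ideal) (auto intro!: nat_pow_closed mvar_in_carrier)
qed

lemma cring_trunc_ring: "cring (trunc_ring F q n)"
  unfolding trunc_ring_def
  by (rule ideal.quotient_is_cring[OF ideal_trunc_ideal cring_mpoly_ring])

lemma trunc_class_in_carrier:
  "p \<in> carrier (mpoly_ring F n) \<Longrightarrow> trunc_class F q n p \<in> carrier (trunc_ring F q n)"
  by (auto simp: trunc_class_def trunc_ring_def FactRing_def A_RCOSETS_def' )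

lemma cring_A_alg: "cring (A_alg F q n e)"
proof -
  interpret cring "trunc_ring F q n" by (rule cring_trunc_ring)
  have "subring (generate_ring (trunc_ring F q n)
        ({trunc_class F q n (mconst c) | c. True} \<union>
         {trunc_monom F q n i | i. [(\<Sum>j = 1..n. q ^ (j - 1) * i j) = 0] (mod e)}))
        (trunc_ring F q n)"
    by (rule generate_ring_is_subring)
       (auto simp: trunc_monom_def Pi_def
          intro!: trunc_class_in_carrier mconst_in_carrier finprod_closed nat_pow_closed mvar_in_carrier)
  then show ?thesis
    unfolding A_alg_def by (intro subcring_iff[THEN iffD1] subcringI' subringE(1))
qed

end

(*
  A product of l nonzero monomials of A(q,n,e) is nonzero iff their exponent vectors add up to a
  vector with all entries at most q - 1. A nonzero exponent vector whose weight vanishes modulo e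
  has total degree at least m, so l <= n (q - 1) / m; this bounds the nilpotency index of the
  radical, which is spanned by the nonconstant monomials.

  Conversely, the weights q^(j-1) run through the subgroup S generated by q in Z/e, each element
  occurring N = n (q - 1) / |S| times, and one has to cut out of N copies of S as many disjoint
  zero sums as N |S| / m allows. The |S| translates of a zero sum of length m fill m copies of S
  exactly, so only N modulo m matters. Moreover gcd(e, q - 1) divides both N and m, which leaves
  very few cases for e <= 32. Most are settled by the cosets of a subgroup with vanishing sum, and
  the others by explicit packings.
*)
theory Submission
  imports
    Defs
    "HOL-Library.Code_Binary_Nat"
    "HOL-Number_Theory.Pocklington"
begin

section \<open>Packing zero sums\<close>

text \<open>Although \<open>q\<close> and \<open>n\<close> are unbounded, they enter the packing
  problem only through \<open>q mod e\<close> and N. Modulo gcd(e, q - 1) every power of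
  \<open>q\<close> is 1, so a zero sum of length t has the value t there; hence the gcd divides m.
  It divides N because |S| divides n, which makes N a multiple of q - 1. Whole blocks of m copies of
  S lose nothing to rounding, so the floor has to be attained only for the remainders 0 < b < m
  divisible by the gcd. That is the real obstacle: counting lengths bounds the number of zero sums
  from above, but a packing that reaches the floor must be exhibited for every remaining triple of
  e, q mod e and b. If m equals the gcd, no remainder is left. If -1 lies in S and e > 2, then m = 2
  and the pairs x, -x pack a single copy of S. Zero sums are multisets of residues, and disjointness
  respects multiplicities; it is therefore stated as an inclusion of their total in V.\<close>

definition packs :: "nat \<Rightarrow> nat multiset \<Rightarrow> nat \<Rightarrow> bool" where
  "packs e V r \<longleftrightarrow> (\<exists>Ms. size Ms = r \<and> (\<forall>X\<in>#Ms. X \<noteq> {#} \<and> e dvd sum_mset X) \<and> sum_mset Ms \<subseteq># V)"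

lemma packs_0 [simp]: "packs e V 0"
  unfolding packs_def by (intro exI[of _ "{#}"]) simp

lemma packs_add:
  assumes "packs e V r" "packs e W s"
  shows "packs e (V + W) (r + s)"
proof -
  from assms obtain Ms Ns where
    "size Ms = r" "\<forall>X\<in>#Ms. X \<noteq> {#} \<and> e dvd sum_mset X" "sum_mset Ms \<subseteq># V"
    "size Ns = s" "\<forall>X\<in>#Ns. X \<noteq> {#} \<and> e dvd sum_mset X" "sum_mset Ns \<subseteq># W"
    unfolding packs_def by blast
  then show ?thesis
    unfolding packs_def by (intro exI[of _ "Ms + Ns"]) (auto intro: subset_mset.add_mono)
qed

lemma packs_repeat:
  assumes "packs e V r"
  shows "packs e (repeat_mset k V) (k * r)"
proof (induction k)
  case (Suc k)
  with packs_add[OF assms] show ?case by simp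
qed simp

lemma packs_le:
  assumes "packs e V r" "s \<le> r"
  shows "packs e V s"
proof -
  from assms obtain Ms where Ms:
    "size Ms = r" "\<forall>X\<in>#Ms. X \<noteq> {#} \<and> e dvd sum_mset X" "sum_mset Ms \<subseteq># V"
    unfolding packs_def by blast
  obtain xs where xs: "mset xs = Ms" using ex_mset by blast
  have "Ms = mset (take s xs) + mset (drop s xs)"
    by (simp add: xs flip: mset_append)
  then have "sum_mset (mset (take s xs)) \<subseteq># sum_mset Ms" by simp
  with Ms(3) have "sum_mset (mset (take s xs)) \<subseteq># V" by (rule subset_mset.order_trans[rotated])
  moreover have "size (mset (take s xs)) = s"
    using Ms(1) assms(2) by (auto simp flip: xs)
  moreover have "X \<in># Ms" if "X \<in># mset (take s xs)" for X
    using that by (auto simp flip: xs dest: in_set_takeD)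
  ultimately show ?thesis
    using Ms(2) unfolding packs_def by blast
qed

text \<open>Packings are found among residues but are needed among positions, that is, variables.
  Positions with equal residues are interchangeable, so blocks can be lifted one at a time: a
  splitting of the image into a block and a rest comes from a splitting of \<open>M\<close>.\<close>

lemma sub_image_mset_pullback:
  "sum_mset Ms \<subseteq># image_mset f M \<Longrightarrow> \<exists>Ns. Ms = image_mset (image_mset f) Ns \<and> sum_mset Ns \<subseteq># M"
proof (induction Ms arbitrary: M)
  case (add X Ms)
  then obtain C where "image_mset f M = X + (sum_mset Ms + C)"
    by (auto simp: subset_mset.le_iff_add add.assoc)
  from image_mset_eq_plusD[OF this] obtain A B
    where AB: "M = A + B" "X = image_mset f A" "sum_mset Ms + C = image_mset f B" by blast
  from AB(3) have "sum_mset Ms \<subseteq># image_mset f B"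
    by (metis mset_subset_eq_add_left)
  from add.IH[OF this] obtain Ns where "Ms = image_mset (image_mset f) Ns" "sum_mset Ns \<subseteq># B"
    by blast
  with AB show ?case by (intro exI[of _ "add_mset A Ns"]) simp
qed auto

lemma packs_image_mset:
  assumes "packs e (image_mset f M) r"
  obtains Ns where "size Ns = r" "\<And>X. X \<in># Ns \<Longrightarrow> X \<noteq> {#} \<and> e dvd sum_mset (image_mset f X)"
    "sum_mset Ns \<subseteq># M"
proof -
  from assms obtain Ms where Ms: "size Ms = r" "\<forall>X\<in>#Ms. X \<noteq> {#} \<and> e dvd sum_mset X"
    "sum_mset Ms \<subseteq># image_mset f M"
    unfolding packs_def by blast
  from sub_image_mset_pullback[OF Ms(3)] obtain Ns
    where "Ms = image_mset (image_mset f) Ns" "sum_mset Ns \<subseteq># M" by blast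
  with Ms that[of Ns] show ?thesis by auto
qed

section \<open>The cyclic group of powers of \<open>q\<close> modulo \<open>e\<close> and its zero
  sums\<close>

lemma sum_singletons: "finite A \<Longrightarrow> (\<Sum>x\<in>A. {#f x#}) = image_mset f (mset_set A)"
  by (induction A rule: finite_induct) simp_all

lemma mset_set_lessThan_add:
  "mset_set {..<a + b :: nat} = mset_set {..<a} + image_mset ((+) a) (mset_set {..<b})"
proof -
  have "{..<a + b} = {..<a} \<union> (+) a ` {..<b}"
    by (auto simp: image_iff) (metis le_add_diff_inverse linorder_not_less nat_add_left_cancel_less lessThan_iff)
  moreover have "image_mset ((+) a) (mset_set {..<b}) = mset_set ((+) a ` {..<b})"
    by (rule image_mset_mset_set) simp
  moreover have "{..<a} \<inter> (+) a ` {..<b} = {}" by auto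
  ultimately show ?thesis
    by (simp add: mset_set_Union)
qed

text \<open>For coprime \<open>e\<close> and \<open>q\<close> this is the subgroup generated by
  \<open>q\<close> in the units of Z/e, given by least residues. Nonnegative exponents suffice since
  \<open>q\<close> has finite order.\<close>

definition power_residues :: "nat \<Rightarrow> nat \<Rightarrow> nat set" where
  "power_residues e q = range (\<lambda>j. q ^ j mod e)"

lemma power_residues_mod [simp]: "power_residues e (q mod e) = power_residues e q"
  by (simp add: power_residues_def power_mod)

lemma power_residues_less: "e > 0 \<Longrightarrow> x \<in> power_residues e q \<Longrightarrow> x < e"
  by (auto simp: power_residues_def)

lemma finite_power_residues [simp]: "e > 0 \<Longrightarrow> finite (power_residues e q)"
  by (rule finite_subset[of _ "{..<e}"]) (auto dest: power_residues_less)

lemma power_residues_mult: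
  "x \<in> power_residues e q \<Longrightarrow> y \<in> power_residues e q \<Longrightarrow> x * y mod e \<in> power_residues e q"
  by (auto simp: power_residues_def mod_mult_eq simp flip: power_add)

lemma one_mem_power_residues: "1 mod e \<in> power_residues e q"
  by (auto simp: power_residues_def intro!: range_eqI[of _ _ 0])

lemma coprime_power_residues: "coprime e q \<Longrightarrow> x \<in> power_residues e q \<Longrightarrow> coprime x e"
  by (cases "e = 0") (auto simp: power_residues_def coprime_commute[of e])

lemma power_residues_eq_image:
  assumes "coprime e q"
  shows "power_residues e q = (\<lambda>j. q ^ j mod e) ` {..<ord e q}"
proof -
  have "q ^ j mod e = q ^ (j mod ord e q) mod e" for j
    using order_divides_expdiff[OF assms, of j "j mod ord e q"] by (simp add: cong_def)
  moreover have "j mod ord e q < ord e q" for j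
    using assms by simp
  ultimately show ?thesis
    unfolding power_residues_def by fast
qed

lemma card_power_residues: "coprime e q \<Longrightarrow> card (power_residues e q) = ord e q"
  by (simp add: power_residues_eq_image card_image inj_power_mod)

lemma mset_set_power_residues:
  "coprime e q \<Longrightarrow> mset_set (power_residues e q) = image_mset (\<lambda>j. q ^ j mod e) (mset_set {..<ord e q})"
  by (simp add: power_residues_eq_image image_mset_mset_set inj_power_mod)

text \<open>The exponents form \<open>k\<close> full periods, and each period runs through the group
  once.\<close>

lemma mset_powers_mod:
  assumes "coprime e q"
  shows "image_mset (\<lambda>j. q ^ j mod e) (mset_set {..<k * ord e q}) = repeat_mset k (mset_set (power_residues e q))"
proof (induction k)
  case (Suc k)
  have "q ^ (k * ord e q + j) mod e = q ^ j mod e" for j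
    using order_divides_expdiff[OF assms, of "k * ord e q + j" j] by (simp add: cong_def)
  with Suc show ?case
    by (simp add: mset_set_lessThan_add[of "k * ord e q" "ord e q"] add.commute[of "ord e q"]
          mset_set_power_residues[OF assms] multiset.map_comp comp_def)
qed simp

text \<open>Multiplication by a unit can be cancelled, and an injective map of a finite set into
  itself is onto.\<close>

lemma image_mult_power_residues:
  assumes "coprime e q" "e > 0" "x \<in> power_residues e q"
  shows "image_mset (\<lambda>s. s * x mod e) (mset_set (power_residues e q)) = mset_set (power_residues e q)"
proof -
  let ?S = "power_residues e q"
  have inj: "inj_on (\<lambda>s. s * x mod e) ?S"
  proof
    fix s t assume "s \<in> ?S" "t \<in> ?S" "s * x mod e = t * x mod e"
    then have "[s = t] (mod e)"
      using cong_mult_rcancel_nat[of x e s t] coprime_power_residues[OF assms(1,3)] by (simp add: cong_def)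
    with \<open>s \<in> ?S\<close> \<open>t \<in> ?S\<close> show "s = t"
      using assms(2) power_residues_less[of e] by (metis cong_less_modulus_unique_nat)
  qed
  moreover have "(\<lambda>s. s * x mod e) ` ?S = ?S"
    using assms inj by (intro endo_inj_surj) (auto intro: power_residues_mult)
  ultimately show ?thesis
    by (simp add: image_mset_mset_set)
qed

text \<open>Length 0 qualifies trivially, so minimality statements carry the condition
  \<open>t > 0\<close> separately.\<close>

definition zero_sum :: "nat \<Rightarrow> nat \<Rightarrow> nat \<Rightarrow> bool" where
  "zero_sum e q t \<longleftrightarrow> (\<exists>x. (\<forall>k<t. x k \<in> power_residues e q) \<and> e dvd (\<Sum>k<t. x k))"

lemma size_sum_singletons: "size (\<Sum>k<t::nat. {#f k#}) = t"
  by (induction t) simp_all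

lemma sum_mset_sum_singletons: "sum_mset (\<Sum>k<t::nat. {#f k#}) = (\<Sum>k<t. f k)"
  by (induction t) (simp_all add: add.commute)

lemma sum_const_mset: "(\<Sum>k<t::nat. V) = repeat_mset t (V :: 'a multiset)"
  by (induction t) simp_all

text \<open>The translates of a zero sum by all of \<open>\<langle>q\<rangle>\<close> use every residue equally often.\<close>

lemma packs_translates:
  assumes "coprime e q" "e > 0" "zero_sum e q t" "t > 0"
  shows "packs e (repeat_mset t (mset_set (power_residues e q))) (ord e q)"
proof -
  let ?S = "power_residues e q"
  from assms obtain x where x: "\<forall>k<t. x k \<in> ?S" "e dvd (\<Sum>k<t. x k)"
    unfolding zero_sum_def by blast
  define X where "X s = (\<Sum>k<t. {#s * x k mod e#})" for s
  \<comment> \<open>Double counting: for a fixed place \<open>k\<close> in the zero sum, the entries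
    \<open>s * x k\<close> run through the whole group as \<open>s\<close> does.\<close>
  have "(\<Sum>s\<in>?S. X s) = (\<Sum>k<t. \<Sum>s\<in>?S. {#s * x k mod e#})"
    unfolding X_def by (rule sum.swap)
  also have "\<dots> = (\<Sum>k<t. mset_set ?S)"
    using assms(1,2) x(1) by (intro sum.cong) (simp_all add: sum_singletons image_mult_power_residues)
  finally have "sum_mset (image_mset X (mset_set ?S)) = repeat_mset t (mset_set ?S)"
    by (simp only: sum_const_mset sum_unfold_sum_mset[symmetric])
  moreover have "X s \<noteq> {#}" for s
    using size_sum_singletons[of "\<lambda>k. s * x k mod e" t] assms(4) by (metis X_def less_irrefl size_empty)
  moreover have "e dvd sum_mset (X s)" for s
  proof -
    have "e dvd s * (\<Sum>k<t. x k)" using x(2) by (rule dvd_mult)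
    then show ?thesis
      by (simp add: X_def sum_mset_sum_singletons dvd_eq_mod_eq_0 mod_sum_eq sum_distrib_left)
  qed
  ultimately show ?thesis
    unfolding packs_def using card_power_residues[OF assms(1)]
    by (intro exI[of _ "image_mset X (mset_set ?S)"]) auto
qed

lemma zero_sum_iff: "zero_sum e q t \<longleftrightarrow> (\<exists>i. e dvd (\<Sum>k = 1..t. q ^ i k))"
proof
  assume "zero_sum e q t"
  then obtain x where x: "\<forall>k<t. x k \<in> power_residues e q" "e dvd (\<Sum>k<t. x k)"
    unfolding zero_sum_def by blast
  from x(1) have "\<forall>k<t. \<exists>j. x k = q ^ j mod e" by (auto simp: power_residues_def)
  then obtain j where j: "\<And>k. k < t \<Longrightarrow> x k = q ^ j k mod e" by metis
  have "(\<Sum>k = 1..t. q ^ j (k - 1)) = (\<Sum>k<t. q ^ j k)"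
    by (simp add: sum.atLeast1_atMost_eq)
  moreover have "(\<Sum>k<t. q ^ j k) mod e = (\<Sum>k<t. x k) mod e"
    using j by (subst mod_sum_eq[symmetric]) simp
  ultimately show "\<exists>i. e dvd (\<Sum>k = 1..t. q ^ i k)"
    using x(2) by (intro exI[of _ "\<lambda>k. j (k - 1)"]) (simp add: dvd_eq_mod_eq_0)
next
  assume "\<exists>i. e dvd (\<Sum>k = 1..t. q ^ i k)"
  then obtain i where "e dvd (\<Sum>k<t. q ^ i (Suc k))"
    by (auto simp: sum.atLeast1_atMost_eq)
  then show "zero_sum e q t"
    unfolding zero_sum_def
    by (intro exI[of _ "\<lambda>k. q ^ i (Suc k) mod e"]) (simp add: power_residues_def dvd_eq_mod_eq_0 mod_sum_eq)
qed

lemma m_number_eq_Least: "m_number q e = (LEAST t. t > 0 \<and> zero_sum e q t)"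
  by (simp add: m_number_def zero_sum_iff)

lemma m_number_mod: "m_number (q mod e) e = m_number q e"
  by (simp add: m_number_eq_Least zero_sum_def)

text \<open>The minimum exists because \<open>e\<close> copies of 1 form a zero sum. The resulting
  bound by \<open>e\<close> later guarantees that the search for m has enough fuel.\<close>

lemma m_number_props:
  assumes "e > 0"
  shows "m_number q e > 0" "zero_sum e q (m_number q e)" "t > 0 \<Longrightarrow> zero_sum e q t \<Longrightarrow> m_number q e \<le> t"
    "m_number q e \<le> e"
proof -
  note m = m_number_eq_Least[of q e]
  have e: "e > 0 \<and> zero_sum e q e"
    using assms one_mem_power_residues[of e q] unfolding zero_sum_def
    by (intro conjI exI[of _ "\<lambda>_. 1 mod e"]) auto
  from LeastI[of "\<lambda>t. t > 0 \<and> zero_sum e q t", OF this] m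
  show "m_number q e > 0" "zero_sum e q (m_number q e)" by auto
  show *: "t > 0 \<Longrightarrow> zero_sum e q t \<Longrightarrow> m_number q e \<le> t" for t
    unfolding m by (intro Least_le) simp
  show "m_number q e \<le> e" using * e by blast
qed

text \<open>Modulo the gcd every power of \<open>q\<close> is 1, so the sum is congruent to its
  number of terms.\<close>

lemma zero_sum_dvd:
  assumes "zero_sum e q t" "q > 0"
  shows "gcd e (q - 1) dvd t"
proof -
  let ?c = "gcd e (q - 1)"
  obtain i where "e dvd (\<Sum>k = 1..t. q ^ i k)"
    using assms(1) zero_sum_iff by blast
  then have "?c dvd (\<Sum>k = 1..t. q ^ i k)"
    by (rule dvd_trans[OF gcd_dvd1])
  moreover have "[(\<Sum>k = 1..t. q ^ i k) = (\<Sum>k = 1..t. 1)] (mod ?c)"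
  proof (rule cong_sum)
    fix k
    have "[q = 1] (mod ?c)" using assms(2) by (simp add: cong_altdef_nat)
    then show "[q ^ i k = 1] (mod ?c)" using cong_pow[of q 1 ?c "i k"] by simp
  qed
  ultimately show ?thesis
    by (simp add: cong_dvd_iff)
qed

text \<open>Since the translates of a shortest zero sum pack \<open>m\<close> copies of \<open>\<langle>q\<rangle>\<close> perfectly, only
  the multiplicity modulo \<open>m\<close> matters.\<close>

lemma packs_periodic:
  assumes "coprime e q" "e > 0" "q > 0" "gcd e (q - 1) dvd N"
    and base: "\<And>b. b < m_number q e \<Longrightarrow> gcd e (q - 1) dvd b \<Longrightarrow>
      packs e (repeat_mset b (mset_set (power_residues e q))) (b * ord e q div m_number q e)"
  shows "packs e (repeat_mset N (mset_set (power_residues e q))) (N * ord e q div m_number q e)"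
proof -
  define m where "m = m_number q e"
  define a b where "a = N div m" and "b = N mod m"
  let ?V = "mset_set (power_residues e q)"
  note m = m_number_props[OF assms(2), of q, folded m_def]
  have N: "N = a * m + b" by (simp add: a_def b_def)
  have "gcd e (q - 1) dvd b"
    unfolding b_def using assms(4) zero_sum_dvd[OF m(2) assms(3)] by (simp add: dvd_mod)
  then have "packs e (repeat_mset b ?V) (b * ord e q div m)"
    using base m(1) by (simp add: m_def b_def)
  moreover have "packs e (repeat_mset a (repeat_mset m ?V)) (a * ord e q)"
    by (intro packs_repeat packs_translates assms m)
  ultimately have "packs e (repeat_mset N ?V) (a * ord e q + b * ord e q div m)"
    using packs_add by (fastforce simp: N repeat_mset_distrib)
  moreover have "N * ord e q div m = a * ord e q + b * ord e q div m"
    using m(1) by (simp add: N ring_distribs mult.assoc mult.left_commute[of _ m])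
  ultimately show ?thesis by (simp add: m_def)
qed

section \<open>From packings to exponent vectors\<close>

lemma sum_mset_image_mset_count:
  fixes f :: "nat \<Rightarrow> nat"
  shows "set_mset X \<subseteq> {..<n} \<Longrightarrow> sum_mset (image_mset f X) = (\<Sum>j<n. f j * count X j)"
proof (induction X)
  case (add a X)
  have "(\<Sum>j<n. f j * count (add_mset a X) j) = (\<Sum>j<n. f j * count X j + (if j = a then f j else 0))"
    by (intro sum.cong) auto
  with add show ?case by (simp add: sum.distrib)
qed simp

lemma count_sum_list: "count (sum_list xs) j = (\<Sum>k<length xs. count (xs ! k) j)"
  by (induction xs) (simp_all add: sum.lessThan_Suc_shift del: sum.lessThan_Suc)

lemma image_repeat_mset: "image_mset f (repeat_mset k V) = repeat_mset k (image_mset f V)"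
  by (induction k) simp_all

text \<open>The j-th variable supplies q - 1 units of exponent, each of weight q^(j-1). Disjoint
  zero sums among all these units are monomials of A whose product survives the truncation.\<close>

lemma exponent_vectors:
  assumes "coprime e q" "e > 0" "q > 0" "e dvd q ^ n - 1"
    and base: "\<And>b. b < m_number q e \<Longrightarrow> gcd e (q - 1) dvd b \<Longrightarrow>
      packs e (repeat_mset b (mset_set (power_residues e q))) (b * ord e q div m_number q e)"
  obtains v :: "nat \<Rightarrow> nat \<Rightarrow> nat" where
    "\<And>k. k < n * (q - 1) div m_number q e \<Longrightarrow> e dvd (\<Sum>j = 1..n. q ^ (j - 1) * v k j)"
    "\<And>k. k < n * (q - 1) div m_number q e \<Longrightarrow> \<exists>j\<in>{1..n}. v k j > 0"
    "\<And>j. j \<in> {1..n} \<Longrightarrow> (\<Sum>k<n * (q - 1) div m_number q e. v k j) \<le> q - 1"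
proof -
  define f where "f j = q ^ j mod e" for j
  \<comment> \<open>Positions are counted from 0, so \<open>j\<close> stands for the variable with
    index j + 1, available q - 1 times.\<close>
  define M where "M = repeat_mset (q - 1) (mset_set {..<n})"
  define R where "R = n * (q - 1) div m_number q e"
  have "[q ^ n = 1] (mod e)"
    using assms(3,4) by (simp add: cong_altdef_nat)
  \<comment> \<open>Since the order of \<open>q\<close> divides \<open>n\<close>, the weights
    consist of complete periods; this makes (q - 1) * K the multiplicity of each group
    element.\<close>
  then obtain K where K: "n = K * ord e q"
    by (metis dvdE mult.commute ord_divides)
  have "image_mset f M = repeat_mset ((q - 1) * K) (mset_set (power_residues e q))"
    by (simp add: M_def image_repeat_mset f_def[abs_def] K mset_powers_mod[OF assms(1)])
  moreover have "gcd e (q - 1) dvd (q - 1) * K" by (rule dvd_mult2) simp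
  ultimately have "packs e (image_mset f M) ((q - 1) * K * ord e q div m_number q e)"
    using packs_periodic[OF assms(1-3) _ base] by simp
  also have "(q - 1) * K * ord e q div m_number q e = R"
    by (simp add: R_def K mult_ac)
  finally have packing: "packs e (image_mset f M) R" .
  obtain Ns where Ns: "size Ns = R" "\<And>X. X \<in># Ns \<Longrightarrow> X \<noteq> {#} \<and> e dvd sum_mset (image_mset f X)"
    "sum_mset Ns \<subseteq># M"
    by (rule packs_image_mset[OF packing]) blast
  obtain xs where xs: "mset xs = Ns" using ex_mset by blast
  define v where "v k j = count (xs ! k) (j - 1)" for k j
  have len: "length xs = R" using Ns(1) xs by auto
  have mem: "xs ! k \<in># Ns" if "k < R" for k
    using that len by (auto simp flip: xs)
  have sub: "set_mset (xs ! k) \<subseteq> {..<n}" if "k < R" for k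
  proof -
    have "xs ! k \<subseteq># sum_mset Ns" using mem[OF that] by (metis mset_subset_eq_add_left sum_mset.remove)
    then have "set_mset (xs ! k) \<subseteq> set_mset M" using Ns(3) by (meson set_mset_mono subset_mset.order_trans)
    also have "\<dots> \<subseteq> {..<n}" by (auto simp: M_def count_mset_set' simp flip: count_greater_zero_iff split: if_splits)
    finally show ?thesis .
  qed
  show thesis
  proof (rule that[of v, folded R_def])
    fix k assume k: "k < R"
    have "(\<Sum>j = 1..n. q ^ (j - 1) * v k j) = (\<Sum>j<n. q ^ j * count (xs ! k) j)"
      by (simp add: sum.atLeast1_atMost_eq v_def)
    moreover have "e dvd (\<Sum>j<n. f j * count (xs ! k) j)"
      using Ns(2)[OF mem[OF k]] sum_mset_image_mset_count[OF sub[OF k]] by simp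
    moreover have "(\<Sum>j<n. f j * count (xs ! k) j) mod e = (\<Sum>j<n. q ^ j * count (xs ! k) j) mod e"
      by (subst (1 2) mod_sum_eq[symmetric]) (simp add: f_def mod_mult_left_eq)
    ultimately show "e dvd (\<Sum>j = 1..n. q ^ (j - 1) * v k j)"
      by (simp add: dvd_eq_mod_eq_0)
    from Ns(2)[OF mem[OF k]] obtain a where "a \<in># xs ! k" by blast
    with sub[OF k] show "\<exists>j\<in>{1..n}. v k j > 0"
      by (intro bexI[of _ "Suc a"]) (auto simp: v_def)
  next
    fix j assume j: "j \<in> {1..n}"
    have "(\<Sum>k<R. v k j) = count (sum_mset Ns) (j - 1)"
      by (simp add: v_def len sum_mset_sum_list count_sum_list flip: xs)
    also have "\<dots> \<le> count M (j - 1)" using Ns(3) by (simp add: mset_subset_eq_count)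
    also have "\<dots> \<le> q - 1" by (simp add: M_def count_mset_set')
    finally show "(\<Sum>k<R. v k j) \<le> q - 1" .
  qed
qed

text \<open>The powers of g^s form the subgroup of order \<open>m\<close>. If its sum vanishes, so
  does the sum over each of its \<open>s\<close> cosets, and these partition the group.\<close>

lemma packs_subgroup:
  assumes "coprime e g" "ord e g = m * s" "m > 0" "e dvd (\<Sum>l<m. g ^ (l * s))"
  shows "packs e (mset_set (power_residues e g)) s"
proof -
  define f where "f j = g ^ j mod e" for j
  define X where "X i = (\<Sum>l<m. {#f (l * s + i)#})" for i
  \<comment> \<open>Writing each exponent below m * s as l * s + i, the index \<open>i\<close> names
    the coset and \<open>l\<close> the element in it.\<close>
  have blocks: "(\<Sum>l<k. image_mset f (image_mset ((+) (l * s)) (mset_set {..<s}))) = image_mset f (mset_set {..<k * s})" for k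
    by (induction k) (simp_all add: mset_set_lessThan_add[of "_ * s" s] add.commute[of s])
  have "(\<Sum>i<s. X i) = (\<Sum>l<m. \<Sum>i<s. {#f (l * s + i)#})"
    unfolding X_def by (rule sum.swap)
  also have "\<dots> = image_mset f (mset_set {..<m * s})"
    by (simp add: sum_singletons multiset.map_comp comp_def flip: blocks)
  also have "\<dots> = mset_set (power_residues e g)"
    by (simp add: mset_set_power_residues[OF assms(1)] f_def[abs_def] assms(2))
  finally have "sum_mset (image_mset X (mset_set {..<s})) = mset_set (power_residues e g)"
    by (simp only: sum_unfold_sum_mset[symmetric])
  moreover have "X i \<noteq> {#}" for i
    using size_sum_singletons[of "\<lambda>l. f (l * s + i)" m] assms(3) by (metis X_def less_irrefl size_empty)
  moreover have "e dvd sum_mset (X i)" for i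
  proof -
    have "e dvd (\<Sum>l<m. g ^ (l * s)) * g ^ i" using assms(4) by (rule dvd_mult2)
    then show ?thesis
      by (simp add: X_def f_def sum_mset_sum_singletons dvd_eq_mod_eq_0 mod_sum_eq sum_distrib_right power_add)
  qed
  ultimately show ?thesis
    unfolding packs_def by (intro exI[of _ "image_mset X (mset_set {..<s})"]) auto
qed

section \<open>The finite check\<close>

text \<open>Successive multiples of \<open>x\<close> by \<open>g\<close> are collected until 1
  returns. The fuel only ensures termination; \<open>e\<close> is enough, as the order is at most
  \<open>e\<close>.\<close>

fun orbit :: "nat \<Rightarrow> nat \<Rightarrow> nat \<Rightarrow> nat \<Rightarrow> nat list" where
  "orbit 0 e g x = []"
| "orbit (Suc k) e g x = (if x = 1 mod e then [] else x # orbit k e g (x * g mod e))"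

text \<open>The order of the list matters: entry i is g^i mod e, so the elements of a subgroup sit
  at equally spaced indices.\<close>

definition residue_list :: "nat \<Rightarrow> nat \<Rightarrow> nat list" where
  "residue_list e g = 1 mod e # orbit e e g (g mod e)"

text \<open>If \<open>S\<close> lists the sums of \<open>t\<close> residues in \<open>H\<close>, then the shortest zero sum over \<open>H\<close> has length
  \<open>t\<close> plus the result, provided that it is longer than \<open>t\<close> and the fuel \<open>k\<close> suffices.\<close>

fun zero_sum_length :: "nat \<Rightarrow> nat \<Rightarrow> nat list \<Rightarrow> nat list \<Rightarrow> nat" where
  "zero_sum_length 0 e H S = 0"
| "zero_sum_length (Suc k) e H S =
     (if list_ex (\<lambda>h. e - h \<in> set S) H then 1
      else Suc (zero_sum_length k e H (filter (\<lambda>x. list_ex (\<lambda>s. (x + (e - s)) mod e \<in> set H) S) [0..<e])))"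

text \<open>Packings of \<open>b\<close> copies of \<open>\<langle>g\<rangle>\<close>, found by a computer search, for the cases in which neither
  cosets of a subgroup nor a single zero sum suffice. The case \<open>e = 32\<close> needs one for each of two
  subgroups.\<close>

definition packing_table :: "nat \<Rightarrow> nat \<Rightarrow> nat list list list" where
  "packing_table e b =
    (if e = 11 then [[[1,1,9], [3,3,5], [4,4,5,9]]]
     else if e = 16 then [[[1,1,3,11], [3,9,9,11]]]
     else if e = 22 then [[[1,1,5,15], [3,3,5,9,9,15]]]
     else if e = 23 then
       if b = 1 then [[[1,4,18], [2,8,13], [3,6,9,12,16]]]
       else [[[1,4,18], [1,6,16], [2,3,18], [2,8,13], [3,4,16], [6,8,9], [9,12,12,13]]]
     else if e = 26 then [[[1,3,9,1,3,9], [1,3,9,1,3,9]]]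
     else if e = 28 then [[[1,1,11,15], [9,9,15,23], [11,23,25,25]]]
     else if e = 29 then
       if b = 2 then [[[1,1,7,20], [16,23,23,25], [7,16,20,24,24,25]]]
       else [[[1,1,7,20], [1,7,25,25], [16,23,23,25], [16,23,24,24], [7,16,20,20,24]]]
     else if e = 32 then
       [[[1,1,3,27], [3,9,9,11], [11,17,17,19], [19,25,25,27]],
        [[1,1,7,23], [7,17,17,23]]]
     else [])"

text \<open>An evaluable certificate for \<open>packs\<close>. Multiplicities need testing only at
  residues that occur, and residues outside the group are rejected by the same pass.\<close>

definition valid_packing :: "nat \<Rightarrow> nat \<Rightarrow> nat list \<Rightarrow> nat list list \<Rightarrow> bool" where
  "valid_packing e b H L \<longleftrightarrow> list_all (\<lambda>X. X \<noteq> [] \<and> sum_list X mod e = 0) L \<and>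
     (let c = concat L in list_all (\<lambda>h. h \<in> set H \<and> length (filter ((=) h) c) \<le> b) c)"

text \<open>\<open>g + e - 1\<close> stands for \<open>q - 1\<close> modulo \<open>e\<close>, in a form that avoids truncated subtraction.\<close>

definition packing_check :: "nat \<Rightarrow> nat \<Rightarrow> bool" where
  "packing_check e g = (let H = residue_list e g in e - 1 \<in> set H \<or>
     (let c = gcd e (g + e - 1); d = length H; m = zero_sum_length e e H [0] in
       m = c \<or>
       d mod m = 0 \<and> sum_list (map (\<lambda>l. H ! (l * (d div m))) [0..<m]) mod e = 0 \<or>
       list_all (\<lambda>b. list_ex (\<lambda>L. b * d div m \<le> length L \<and> valid_packing e b H L)
           ([concat (replicate b H)] # packing_table e b)) (filter (\<lambda>b. b mod c = 0) [1..<m])))"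

section \<open>Soundness of the check\<close>

lemma orbit_eq:
  assumes "coprime e g"
  shows "1 \<le> i \<Longrightarrow> i \<le> ord e g \<Longrightarrow> ord e g \<le> i + k \<Longrightarrow>
    orbit k e g (g ^ i mod e) = map (\<lambda>j. g ^ j mod e) [i..<ord e g]"
proof (induction k arbitrary: i)
  case (Suc k)
  \<comment> \<open>Within the exponents from 1 to the order, only the order itself gives 1, so the
    stopping test fires exactly after one period. Exponent 0 would stop it at once, which is why
    \<open>residue_list\<close> adds 1 by hand.\<close>
  have *: "g ^ i mod e = 1 mod e \<longleftrightarrow> i = ord e g"
    using ord_divides[of g i e] Suc.prems assms by (auto simp: cong_def dest: dvd_imp_le)
  show ?case
  proof (cases "i = ord e g")
    case False
    then have "i < ord e g" using Suc.prems by simp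
    moreover have "(g ^ i mod e) * g mod e = g ^ Suc i mod e"
      by (simp add: mod_simps mult.commute)
    ultimately show ?thesis
      using * Suc.IH[of "Suc i"] Suc.prems by (simp add: upt_conv_Cons del: power_Suc)
  qed (use * in simp)
qed simp

lemma ord_le:
  assumes "coprime e g" "e > 0"
  shows "ord e g \<le> e"
proof -
  have "card (power_residues e g) \<le> card {..<e}"
    using assms(2) by (intro card_mono) (auto dest: power_residues_less)
  then show ?thesis using card_power_residues[OF assms(1)] by simp
qed

lemma residue_list_eq:
  assumes "coprime e g" "e > 0"
  shows "residue_list e g = map (\<lambda>j. g ^ j mod e) [0..<ord e g]"
proof -
  have "ord e g > 0" using assms by simp
  moreover from this have "orbit e e g (g mod e) = map (\<lambda>j. g ^ j mod e) [1..<ord e g]"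
    using orbit_eq[OF assms(1), of 1 e] ord_le[OF assms] by (simp add: Suc_leI)
  ultimately show ?thesis by (simp add: residue_list_def upt_conv_Cons)
qed

text \<open>Specifies the list of sums that \<open>zero_sum_length\<close> carries along.\<close>

definition partial_sums :: "nat \<Rightarrow> nat \<Rightarrow> nat \<Rightarrow> nat set" where
  "partial_sums e q t =
     {x. x < e \<and> (\<exists>y. (\<forall>k<t. y k \<in> power_residues e q) \<and> [(\<Sum>k<t. y k) = x] (mod e))}"

lemma partial_sums_0: "e > 0 \<Longrightarrow> partial_sums e q 0 = {0}"
  by (auto simp: partial_sums_def cong_def)

text \<open>A residue x is a sum of one more term exactly when x - s lies in the group for some
  earlier sum s. Adding e - s expresses this difference in the naturals, in the form that the search
  evaluates.\<close>

lemma partial_sums_Suc: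
  assumes "e > 0"
  shows "partial_sums e q (Suc t) =
    {x. x < e \<and> (\<exists>s\<in>partial_sums e q t. (x + (e - s)) mod e \<in> power_residues e q)}" (is "?L = ?R")
proof (intro equalityI subsetI)
  fix x assume "x \<in> ?L"
  then obtain y where y: "x < e" "\<forall>k<Suc t. y k \<in> power_residues e q" "[(\<Sum>k<t. y k) + y t = x] (mod e)"
    by (auto simp: partial_sums_def)
  define s where "s = (\<Sum>k<t. y k) mod e"
  have s: "s < e" "s \<in> partial_sums e q t"
    using y assms by (auto simp: partial_sums_def s_def intro!: exI[of _ y])
  have "[x = s + y t] (mod e)"
    using y(3) by (simp add: s_def cong_def mod_simps)
  then have "[x + (e - s) = s + y t + (e - s)] (mod e)"
    by (intro cong_add) simp_all
  also have "s + y t + (e - s) = y t + e" using s(1) by simp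
  finally have "(x + (e - s)) mod e = y t"
    using y(2) power_residues_less[OF assms, of "y t" q] by (simp add: cong_def)
  then show "x \<in> ?R" using y s by (auto intro!: bexI[of _ s])
next
  fix x assume "x \<in> ?R"
  then obtain s y where y: "x < e" "s < e" "(x + (e - s)) mod e \<in> power_residues e q"
    "\<forall>k<t. y k \<in> power_residues e q" "[(\<Sum>k<t. y k) = s] (mod e)"
    by (auto simp: partial_sums_def)
  have "[(\<Sum>k<t. y k) + (x + (e - s)) mod e = s + (x + (e - s))] (mod e)"
    using y(5) by (intro cong_add) simp_all
  also have "s + (x + (e - s)) = x + e" using y(2) by simp
  finally have "[(\<Sum>k<t. y k) + (x + (e - s)) mod e = x] (mod e)" by (simp add: cong_def)
  with y show "x \<in> ?L"
    unfolding partial_sums_def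
    by (intro CollectI conjI exI[of _ "y(t := (x + (e - s)) mod e)"]) (auto simp: less_Suc_eq)
qed

text \<open>Splitting off the last term h, the other terms must add up to -h. As h is a unit and e >
  1, h is not 0, so e - h is the least residue of -h.\<close>

lemma zero_sum_Suc_iff:
  assumes "coprime e q" "e > 1"
  shows "zero_sum e q (Suc t) \<longleftrightarrow> (\<exists>h\<in>power_residues e q. e - h \<in> partial_sums e q t)"
proof
  assume "zero_sum e q (Suc t)"
  then obtain y where y: "\<forall>k<Suc t. y k \<in> power_residues e q" "[(\<Sum>k<t. y k) + y t = 0] (mod e)"
    by (auto simp: zero_sum_def cong_0_iff)
  have h: "y t < e" "y t \<noteq> 0"
    using y(1) assms coprime_power_residues[OF assms(1), of "y t"] power_residues_less[of e "y t" q] 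
    by (auto intro!: Nat.gr0I)
  have "[(\<Sum>k<t. y k) + y t + (e - y t) = 0 + (e - y t)] (mod e)"
    using y(2) by (intro cong_add) simp_all
  then have "[(\<Sum>k<t. y k) = e - y t] (mod e)" using h(1) by (simp add: cong_def)
  with y h have "e - y t \<in> partial_sums e q t" by (auto simp: partial_sums_def intro!: exI[of _ y])
  with y show "\<exists>h\<in>power_residues e q. e - h \<in> partial_sums e q t" by blast
next
  assume "\<exists>h\<in>power_residues e q. e - h \<in> partial_sums e q t"
  then obtain h y where y: "h \<in> power_residues e q" "\<forall>k<t. y k \<in> power_residues e q"
    "[(\<Sum>k<t. y k) = e - h] (mod e)"
    by (auto simp: partial_sums_def)
  have "h < e" using y(1) assms(2) power_residues_less[of e h q] by simp
  have "[(\<Sum>k<t. y k) + h = e - h + h] (mod e)"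
    using y(3) by (intro cong_add) simp_all
  also have "e - h + h = e" using \<open>h < e\<close> by simp
  finally have "e dvd (\<Sum>k<t. y k) + h" by (simp add: cong_def dvd_eq_mod_eq_0)
  with y show "zero_sum e q (Suc t)"
    unfolding zero_sum_def by (intro exI[of _ "y(t := h)"]) (auto simp: less_Suc_eq)
qed

text \<open>As the search has already passed all lengths up to \<open>t\<close> without a zero sum,
  the first success at length t + 1 is the minimum; otherwise the invariant moves on to t +
  1.\<close>

lemma zero_sum_length_eq:
  assumes "coprime e q" "e > 1" "set H = power_residues e q"
  shows "set L = partial_sums e q t \<Longrightarrow> t < m_number q e \<Longrightarrow> m_number q e \<le> t + k \<Longrightarrow>
    zero_sum_length k e H L = m_number q e - t"
proof (induction k arbitrary: t L)
  case (Suc k)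
  have e: "e > 0" using assms(2) by simp
  have *: "list_ex (\<lambda>h. e - h \<in> set L) H \<longleftrightarrow> zero_sum e q (Suc t)"
    by (simp add: list_ex_iff assms(3) Suc.prems(1) zero_sum_Suc_iff[OF assms(1,2)])
  show ?case
  proof (cases "zero_sum e q (Suc t)")
    case True
    then have "m_number q e = Suc t"
      using m_number_props(3)[OF e, of "Suc t" q] Suc.prems(2) by simp
    with True * show ?thesis by simp
  next
    case False
    with m_number_props(2)[OF e, of q] have "m_number q e \<noteq> Suc t" by metis
    moreover have "set (filter (\<lambda>x. list_ex (\<lambda>s. (x + (e - s)) mod e \<in> set H) L) [0..<e]) =
        partial_sums e q (Suc t)"
      by (auto simp: partial_sums_Suc[OF e] list_ex_iff assms(3) Suc.prems(1))
    ultimately show ?thesis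
      using False * Suc.prems Suc.IH[of _ "Suc t"] by simp
  qed
qed simp

lemma valid_packing_imp_packs:
  assumes "valid_packing e b H L" "set H = power_residues e g" "e > 0" "r \<le> length L"
  shows "packs e (repeat_mset b (mset_set (power_residues e g))) r"
proof -
  have "count (mset (concat L)) h \<le> count (repeat_mset b (mset_set (power_residues e g))) h" for h
  proof (cases "h \<in> set (concat L)")
    case True
    then have "h \<in> set H \<and> length (filter ((=) h) (concat L)) \<le> b"
      using assms(1) unfolding valid_packing_def Let_def list_all_iff by blast
    then show ?thesis
      using assms(2,3) by (simp add: count_mset_set' count_mset count_list_eq_length_filter)
  next
    case False
    then have "count (mset (concat L)) h = 0" by (simp only: count_mset_0_iff) simp
    then show ?thesis by (simp only: le0)
  qed
  moreover have "sum_mset (mset (map mset L)) = mset (concat L)"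
    by (simp only: sum_mset_sum_list mset_concat)
  ultimately have "sum_mset (mset (map mset L)) \<subseteq># repeat_mset b (mset_set (power_residues e g))"
    by (simp only: mset_subset_eqI)
  then have "packs e (repeat_mset b (mset_set (power_residues e g))) (length L)"
    unfolding packs_def using assms(1)
    by (intro exI[of _ "mset (map mset L)"])
       (auto simp: valid_packing_def list_all_iff sum_mset_sum_list dvd_eq_mod_eq_0)
  then show ?thesis using assms(4) by (rule packs_le)
qed

text \<open>The terms 1 and e - 1 cancel, while a single unit is never divisible by e > 1.\<close>

lemma m_number_eq_2:
  assumes "coprime e g" "e > 1" "e - 1 \<in> power_residues e g"
  shows "m_number g e = 2"
proof -
  have e: "e > 0" using assms(2) by simp
  have "zero_sum e g 2"
    using assms one_mem_power_residues[of e g] unfolding zero_sum_def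
    by (intro exI[of _ "\<lambda>k. if k = 0 then 1 else e - 1"]) (auto simp: numeral_2_eq_2)
  moreover have "\<not> zero_sum e g 1"
  proof
    assume "zero_sum e g 1"
    then obtain x where x: "x \<in> power_residues e g" "e dvd x" by (auto simp: zero_sum_def)
    from x(1) have "coprime x e" by (rule coprime_power_residues[OF assms(1)])
    from coprime_common_divisor[OF this x(2)] assms(2) show False by simp
  qed
  ultimately show ?thesis
    using m_number_props(1,2)[OF e, of g] m_number_props(3)[OF e, of 2 g]
    by (cases "m_number g e = 1") auto
qed

text \<open>If \<open>g ^ i \<equiv> -1\<close> with \<open>i\<close> below the order \<open>d\<close> of \<open>g\<close>, then \<open>d\<close> divides \<open>2 * i\<close>, so \<open>d = 2 * i\<close>
  unless \<open>e = 2\<close>.\<close>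

lemma packs_minus_one:
  assumes "coprime e g" "e > 2" "e - 1 \<in> power_residues e g"
  shows "packs e (mset_set (power_residues e g)) (ord e g div 2)"
proof -
  from assms obtain i where i: "i < ord e g" "g ^ i mod e = e - 1"
    by (auto simp: power_residues_eq_image)
  have *: "e dvd 1 + g ^ i"
  proof -
    have "(1 + g ^ i) mod e = (1 + (e - 1)) mod e" by (metis i(2) mod_add_right_eq)
    then show ?thesis using assms(2) by (simp add: dvd_eq_mod_eq_0)
  qed
  have "[g ^ (2 * i) = 1] (mod e)"
  proof -
    have "[int g ^ i = - 1] (mod int e)"
      using * by (simp add: cong_iff_dvd_diff add.commute flip: of_nat_power) (metis int_dvd_int_iff of_nat_Suc of_nat_power)
    then have "[(int g ^ i) ^ 2 = (- 1) ^ 2] (mod int e)" by (rule cong_pow)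
    then show ?thesis by (simp add: mult.commute[of 2] power_mult flip: cong_int_iff)
  qed
  then obtain u where u: "2 * i = ord e g * u" by (auto simp: ord_divides')
  have "i \<noteq> 0" using i(2) assms(2) by (auto intro: ccontr)
  with u have "u \<noteq> 0" by (intro notI) simp
  moreover have "\<not> u \<ge> 2"
  proof
    assume "u \<ge> 2"
    then have "ord e g * 2 \<le> ord e g * u" by (rule mult_le_mono2)
    with u i(1) show False by simp
  qed
  ultimately have "u = 1" by simp
  with u have "ord e g = 2 * i" by simp
  moreover have "e dvd (\<Sum>l<2. g ^ (l * i))" using * by (simp add: numeral_2_eq_2)
  ultimately show ?thesis
    using packs_subgroup[OF assms(1), of 2 i] by simp
qed

text \<open>Each disjunct of the check is a sufficient reason of its own; they are treated
  separately once b = 0, which asks for no zero sums, is set aside.\<close>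

lemma packing_check_sound:
  assumes "packing_check e g" "coprime e g" "e > 1" "b < m_number g e" "gcd e (g + e - 1) dvd b"
  shows "packs e (repeat_mset b (mset_set (power_residues e g))) (b * ord e g div m_number g e)"
proof (cases "b = 0")
  case False
  define H where "H = residue_list e g"
  define m where "m = m_number g e"
  define d where "d = ord e g"
  have e: "e > 0" using assms(3) by simp
  have H: "H = map (\<lambda>j. g ^ j mod e) [0..<d]"
    unfolding H_def d_def using assms by (intro residue_list_eq) auto
  have setH: "set H = power_residues e g"
    by (simp add: H power_residues_eq_image[OF assms(2)] d_def atLeast0LessThan)
  have len: "length H = d" by (simp add: H)
  have m: "zero_sum_length e e H [0] = m" "m > 0"
    using zero_sum_length_eq[OF assms(2,3) setH, of "[0]" 0 e] m_number_props[OF e, of g]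
    by (simp_all add: partial_sums_0[OF e] m_def)
  from assms(1) have "e - 1 \<in> power_residues e g \<or> m = gcd e (g + e - 1) \<or>
    d mod m = 0 \<and> sum_list (map (\<lambda>l. H ! (l * (d div m))) [0..<m]) mod e = 0 \<or>
    list_all (\<lambda>b. list_ex (\<lambda>L. b * d div m \<le> length L \<and> valid_packing e b H L)
           ([concat (replicate b H)] # packing_table e b))
      (filter (\<lambda>b. b mod gcd e (g + e - 1) = 0) [1..<m])"
    unfolding packing_check_def Let_def H_def[symmetric] m(1) len setH .
  then show ?thesis
  proof (elim disjE conjE, goal_cases)
    case 1
    then have "m = 2" unfolding m_def using assms(2,3) by (intro m_number_eq_2)
    with False assms(4) have "b = 1" by (simp add: m_def)
    \<comment> \<open>For e = 2 the residues 1 and -1 coincide and cannot be paired inside one copy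
      of the group; but then the gcd is 2 and excludes b = 1.\<close>
    have "e \<noteq> 2"
    proof
      assume "e = 2"
      with assms(2) have "2 dvd gcd e (g + e - 1)" by (simp add: coprime_commute coprime_right_2_iff_odd)
      with assms(5) \<open>b = 1\<close> show False by (metis dvd_trans nat_dvd_1_iff_1 numeral_eq_one_iff semiring_norm(85))
    qed
    with 1 assms(2,3) \<open>b = 1\<close> \<open>m = 2\<close> packs_minus_one[of e g] show ?thesis
      by (simp add: m_def)
  next
    \<comment> \<open>No b with 0 < b < m is divisible by m.\<close>
    case 2
    with assms(4,5) False show ?thesis by (simp add: m_def nat_dvd_not_less)
  next
    \<comment> \<open>The subgroup of order m has vanishing sum, so its cosets pack one copy of the
      group without waste, and b copies are packed by repetition.\<close>
    case 3
    define s where "s = d div m"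
    have d: "d = m * s" using 3(1) by (simp add: s_def mod_0_imp_dvd)
    have "s > 0" using assms(2) d ord_gt_0_iff[of e g] by (metis d_def mult_0_right not_gr0)
    have "sum_list (map (\<lambda>l. H ! (l * s)) [0..<m]) = (\<Sum>l<m. g ^ (l * s) mod e)"
    proof -
      have "H ! (l * s) = g ^ (l * s) mod e" if "l < m" for l
        using that \<open>s > 0\<close> by (simp add: H d)
      then show ?thesis
        by (simp add: interv_sum_list_conv_sum_set_nat atLeast0LessThan)
    qed
    with 3(2) have "(\<Sum>l<m. g ^ (l * s) mod e) mod e = 0" by (simp only: s_def)
    then have "e dvd (\<Sum>l<m. g ^ (l * s))"
      by (simp only: dvd_eq_mod_eq_0 mod_sum_eq)
    with packs_subgroup[OF assms(2), of m s] d m(2) have "packs e (mset_set (power_residues e g)) s"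
      by (simp add: d_def)
    then have "packs e (repeat_mset b (mset_set (power_residues e g))) (b * s)"
      by (rule packs_repeat)
    moreover have "b * ord e g div m_number g e = b * s"
      using m(2) d by (simp add: d_def m_def mult.left_commute[of b])
    ultimately show ?thesis by simp
  next
    \<comment> \<open>The certificate is either the union of all b copies, taken as one zero sum, or
      an entry of the table.\<close>
    case 4
    moreover have "b \<in> set (filter (\<lambda>b. b mod gcd e (g + e - 1) = 0) [1..<m])"
      using assms(4,5) False by (simp add: m_def dvd_imp_mod_0)
    ultimately have "list_ex (\<lambda>L. b * d div m \<le> length L \<and> valid_packing e b H L)
        ([concat (replicate b H)] # packing_table e b)"
      by (simp only: list_all_iff)
    then obtain L where "b * d div m \<le> length L" "valid_packing e b H L"
      by (auto simp only: list_ex_iff)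
    then show ?thesis
      using valid_packing_imp_packs[OF _ setH e] by (simp add: d_def m_def)
  qed
qed simp

text \<open>This is the only place where e is bounded by a concrete number. The value e = 1 is
  absent since it gives m = 1 and leaves no nonzero remainder.\<close>

lemma packing_check_table:
  "list_all (\<lambda>e. list_all (packing_check e) (filter (\<lambda>g. gcd e g = 1) [0..<e])) [2..<33]"
  by code_simp

section \<open>The truncated polynomial algebra\<close>

lemma carrier_mpoly_ring_iff:
  "p \<in> carrier (mpoly_ring F n) \<longleftrightarrow> (\<forall>a\<in>Poly_Mapping.keys p. Poly_Mapping.keys a \<subseteq> {1..n})"
  by (simp add: mpoly_ring_def)

lemma mpoly_ring_sel [simp]:
  "mult (mpoly_ring F n) = (*)" "one (mpoly_ring F n) = 1"
  "zero (mpoly_ring F n) = 0" "add (mpoly_ring F n) = (+)"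
  by (simp_all add: mpoly_ring_def)

lemma uminus_mpoly_ring:
  assumes "p \<in> carrier (mpoly_ring F n)"
  shows "- p \<in> carrier (mpoly_ring F n)" "\<ominus>\<^bsub>mpoly_ring F n\<^esub> p = - p"
proof -
  interpret cring "mpoly_ring F n" by (rule cring_mpoly_ring)
  show *: "- p \<in> carrier (mpoly_ring F n)"
    using assms by (simp add: carrier_mpoly_ring_iff)
  show "\<ominus>\<^bsub>mpoly_ring F n\<^esub> p = - p"
    using minus_equality[of "- p" p] assms * by simp
qed

lemma mvar_nat_pow: 
  "mvar j [^]\<^bsub>mpoly_ring F n\<^esub> (k::nat) = Poly_Mapping.single (Poly_Mapping.single j k) 1"
  by (induction k)
     (simp_all add: nat_pow_def mvar_def Poly_Mapping.mult_single flip: Poly_Mapping.single_add)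

lemma keys_mult_obtain:
  assumes "a \<in> Poly_Mapping.keys (p * r)"
  obtains b c where "b \<in> Poly_Mapping.keys p" "c \<in> Poly_Mapping.keys r" "a = b + c"
  using assms Poly_Mapping.keys_mult[of p r] by blast

lemma sum_monomials:
  "(\<Sum>a\<in>Poly_Mapping.keys p. Poly_Mapping.single a (Poly_Mapping.lookup p a)) = p"
  by (rule poly_mapping_eqI)
     (auto simp: Poly_Mapping.lookup_sum Poly_Mapping.lookup_single when_def Poly_Mapping.in_keys_iff)

lemma monomial_mem_trunc_ideal:
  assumes "Poly_Mapping.keys a \<subseteq> {1..n}" "j \<in> {1..n}" "q \<le> Poly_Mapping.lookup a j"
  shows "Poly_Mapping.single a c \<in> trunc_ideal F q n"
proof -
  interpret ideal "trunc_ideal F q n" "mpoly_ring F n" by (rule ideal_trunc_ideal)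
  define b where "b = a - Poly_Mapping.single j q"
  have a: "a = b + Poly_Mapping.single j q"
    using assms(3) 
    by (intro poly_mapping_eqI) (auto simp: b_def Poly_Mapping.lookup_add Poly_Mapping.lookup_minus Poly_Mapping.lookup_single when_def)
  then have "Poly_Mapping.keys b \<subseteq> {1..n}"
    using assms(1) by (simp add: keys_add_nat)
  then have b: "Poly_Mapping.single b c \<in> carrier (mpoly_ring F n)"
    by (simp add: carrier_mpoly_ring_iff)
  have "{mvar j [^]\<^bsub>mpoly_ring F n\<^esub> q | j. j \<in> {1..n}} \<subseteq> carrier (mpoly_ring F n)"
    using mvar_in_carrier by (auto intro!: nat_pow_closed)
  from genideal_self[OF this] have "mvar j [^]\<^bsub>mpoly_ring F n\<^esub> q \<in> trunc_ideal F q n"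
    using assms(2) unfolding trunc_ideal_def by blast
  then have "Poly_Mapping.single (Poly_Mapping.single j q) 1 \<in> trunc_ideal F q n"
    by (simp add: mvar_nat_pow)
  from I_l_closed[OF this b] show ?thesis
    by (simp add: Poly_Mapping.mult_single a)
qed

text \<open>The ideal is monomial. The polynomials on the right form an ideal containing the
  generators, which gives one direction; conversely such a polynomial is the sum of its terms, each
  a multiple of a generator.\<close>

lemma mem_trunc_ideal_iff:
  "p \<in> trunc_ideal F q n \<longleftrightarrow> p \<in> carrier (mpoly_ring F n) \<and>
     (\<forall>a\<in>Poly_Mapping.keys p. \<exists>j\<in>{1..n}. q \<le> Poly_Mapping.lookup a j)"
  (is "_ \<longleftrightarrow> p \<in> ?C \<and> ?P p")
proof
  interpret cring "mpoly_ring F n" by (rule cring_mpoly_ring)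
  assume "p \<in> trunc_ideal F q n"
  moreover have "trunc_ideal F q n \<subseteq> {p \<in> ?C. ?P p}"
    unfolding trunc_ideal_def
  proof (rule genideal_minimal)
    show "ideal {p \<in> ?C. ?P p} (mpoly_ring F n)"
    proof (rule idealI)
      show "subgroup {p \<in> ?C. ?P p} (add_monoid (mpoly_ring F n))"
      proof (rule add.subgroupI)
        fix p assume p: "p \<in> {p \<in> ?C. ?P p}"
        then show "\<ominus>\<^bsub>mpoly_ring F n\<^esub> p \<in> {p \<in> ?C. ?P p}"
          by (simp add: uminus_mpoly_ring)
      next
        fix p r assume "p \<in> {p \<in> ?C. ?P p}" "r \<in> {p \<in> ?C. ?P p}"
        then show "p \<oplus>\<^bsub>mpoly_ring F n\<^esub> r \<in> {p \<in> ?C. ?P p}"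
          using Poly_Mapping.keys_add[of p r] a_closed[of p r] by auto
      next
        have "0 \<in> {p \<in> ?C. ?P p}" by (simp add: carrier_mpoly_ring_iff)
        then show "{p \<in> ?C. ?P p} \<noteq> {}" by blast
      qed auto
    next
      fix p r assume *: "p \<in> {p \<in> ?C. ?P p}" "r \<in> ?C"
      have "?P (r * p)"
      proof
        fix a assume "a \<in> Poly_Mapping.keys (r * p)"
        then obtain b c where "c \<in> Poly_Mapping.keys p" "a = b + c" by (rule keys_mult_obtain)
        moreover from this * obtain j where "j \<in> {1..n}" "q \<le> Poly_Mapping.lookup c j" by blast
        ultimately show "\<exists>j\<in>{1..n}. q \<le> Poly_Mapping.lookup a j"
          by (auto simp: Poly_Mapping.lookup_add intro!: bexI[of _ j])
      qed
      then show "r \<otimes>\<^bsub>mpoly_ring F n\<^esub> p \<in> {p \<in> ?C. ?P p}" "p \<otimes>\<^bsub>mpoly_ring F n\<^esub> r \<in> {p \<in> ?C. ?P p}"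
        using * m_closed[of r p] by (simp_all add: mult.commute)
    qed unfold_locales
    show "{mvar j [^]\<^bsub>mpoly_ring F n\<^esub> q |j. j \<in> {1..n}} \<subseteq> {p \<in> ?C. ?P p}"
      using mvar_in_carrier
      by (auto simp: mvar_nat_pow carrier_mpoly_ring_iff split: if_splits intro!: bexI)
  qed
  ultimately show "p \<in> ?C \<and> ?P p" by blast
next
  interpret ideal "trunc_ideal F q n" "mpoly_ring F n" by (rule ideal_trunc_ideal)
  assume p: "p \<in> ?C \<and> ?P p"
  have "(\<Sum>a\<in>A. Poly_Mapping.single a (Poly_Mapping.lookup p a)) \<in> trunc_ideal F q n"
    if "finite A" "A \<subseteq> Poly_Mapping.keys p" for A
    using that
  proof (induction A rule: finite_induct)
    case empty
    show ?case using additive_subgroup.zero_closed[OF is_additive_subgroup] by simp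
  next
    case (insert a A)
    then have "a \<in> Poly_Mapping.keys p" by blast
    then have "Poly_Mapping.single a (Poly_Mapping.lookup p a) \<in> trunc_ideal F q n"
      using p monomial_mem_trunc_ideal by (metis carrier_mpoly_ring_iff)
    then show ?case
      using insert additive_subgroup.a_closed[OF is_additive_subgroup] by simp
  qed
  from this[of "Poly_Mapping.keys p"] show "p \<in> trunc_ideal F q n"
    by (simp add: sum_monomials)
qed

lemma trunc_class_ring_hom_cring: 
  "ring_hom_cring (mpoly_ring F n) (trunc_ring F q n) (trunc_class F q n)"
proof -
  interpret ideal "trunc_ideal F q n" "mpoly_ring F n" by (rule ideal_trunc_ideal)
  have "trunc_class F q n = (+>\<^bsub>mpoly_ring F n\<^esub>) (trunc_ideal F q n)"
    by (simp add: fun_eq_iff trunc_class_def)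
  then show ?thesis
    using rcos_ring_hom cring_mpoly_ring cring_trunc_ring
    by (auto simp: trunc_ring_def intro!: ring_hom_cring.intro ring_hom_cring_axioms.intro)
qed

lemma trunc_class_eq_zero_iff:
  assumes "p \<in> carrier (mpoly_ring F n)"
  shows "trunc_class F q n p = \<zero>\<^bsub>trunc_ring F q n\<^esub> \<longleftrightarrow> p \<in> trunc_ideal F q n"
proof -
  interpret ideal "trunc_ideal F q n" "mpoly_ring F n" by (rule ideal_trunc_ideal)
  have "\<zero>\<^bsub>trunc_ring F q n\<^esub> = trunc_ideal F q n"
    by (simp add: trunc_ring_def FactRing_def)
  then show ?thesis
    using a_rcos_self[OF assms] a_rcos_const by (auto simp: trunc_class_def)
qed

definition expvec :: "nat \<Rightarrow> (nat \<Rightarrow> nat) \<Rightarrow> nat \<Rightarrow>\<^sub>0 nat" where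
  "expvec n i = (\<Sum>j = 1..n. Poly_Mapping.single j (i j))"

lemma lookup_expvec: "Poly_Mapping.lookup (expvec n i) j = (if j \<in> {1..n} then i j else 0)"
  by (auto simp: expvec_def Poly_Mapping.lookup_sum Poly_Mapping.lookup_single when_def)

lemma keys_expvec: "Poly_Mapping.keys (expvec n i) \<subseteq> {1..n}"
  by (auto simp: Poly_Mapping.in_keys_iff lookup_expvec split: if_splits)

text \<open>Moving the product from the quotient to the polynomials turns it into a single term, for
  which membership in the ideal can be read off.\<close>

lemma trunc_monom_eq:
  fixes F :: "'f::comm_ring_1 itself"
  shows "trunc_monom F q n i = trunc_class F q n (Poly_Mapping.single (expvec n i) 1)"
proof -
  interpret ring_hom_cring "mpoly_ring F n" "trunc_ring F q n" "trunc_class F q n"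
    by (rule trunc_class_ring_hom_cring)
  define f :: "nat \<Rightarrow> 'f mpol" where "f j = mvar j [^]\<^bsub>mpoly_ring F n\<^esub> i j" for j
  have f: "f \<in> {1..n} \<rightarrow> carrier (mpoly_ring F n)"
    by (auto simp: f_def intro!: R.nat_pow_closed mvar_in_carrier)
  have "trunc_class F q n (mvar j) [^]\<^bsub>trunc_ring F q n\<^esub> i j = trunc_class F q n (f j)"
    if "j \<in> {1..n}" for j
    using that by (simp add: f_def hom_nat_pow mvar_in_carrier)
  then have "trunc_monom F q n i = finprod (trunc_ring F q n) (trunc_class F q n \<circ> f) {1..n}"
    unfolding trunc_monom_def by (intro S.finprod_cong') (auto intro!: hom_closed funcset_mem[OF f])
  also have "\<dots> = trunc_class F q n (finprod (mpoly_ring F n) f {1..n})"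
    by (rule hom_finprod[OF f, symmetric])
  also have "finprod (mpoly_ring F n) f {1..k} = Poly_Mapping.single (expvec k i) 1" if "k \<le> n" for k
    using that
  proof (induction k)
    case (Suc k)
    have "finprod (mpoly_ring F n) f {1..Suc k} = f (Suc k) * finprod (mpoly_ring F n) f {1..k}"
      using Suc.prems f R.finprod_insert[of "{1..k}" "Suc k" f] by (auto simp: atLeastAtMostSuc_conv Pi_def)
    also have "f (Suc k) = Poly_Mapping.single (Poly_Mapping.single (Suc k) (i (Suc k))) 1"
      by (simp add: f_def mvar_nat_pow)
    finally show ?case
      using Suc by (simp add: Poly_Mapping.mult_single expvec_def add.commute)
  qed (simp add: expvec_def)
  finally show ?thesis by simp
qed

section \<open>The filtration by total degree\<close>

definition weight :: "nat \<Rightarrow> nat \<Rightarrow> (nat \<Rightarrow>\<^sub>0 nat) \<Rightarrow> nat" where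
  "weight q n a = (\<Sum>j = 1..n. q ^ (j - 1) * Poly_Mapping.lookup a j)"

definition total_degree :: "nat \<Rightarrow> (nat \<Rightarrow>\<^sub>0 nat) \<Rightarrow> nat" where
  "total_degree n a = (\<Sum>j = 1..n. Poly_Mapping.lookup a j)"

lemma weight_add: "weight q n (a + b) = weight q n a + weight q n b"
  by (simp add: weight_def Poly_Mapping.lookup_add ring_distribs sum.distrib)

lemma total_degree_add: "total_degree n (a + b) = total_degree n a + total_degree n b"
  by (simp add: total_degree_def Poly_Mapping.lookup_add sum.distrib)

lemma weight_zero [simp]: "weight q n 0 = 0"
  by (simp add: weight_def)

text \<open>Divisibility of the weight and a lower bound on the degree are both compatible with
  products. The classes thus form a multiplicative filtration whose stage 0 contains A.\<close>

definition deg_polys :: "'f::comm_ring_1 itself \<Rightarrow> nat \<Rightarrow> nat \<Rightarrow> nat \<Rightarrow> nat \<Rightarrow> 'f mpol set" where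
  "deg_polys F q n e k = {p \<in> carrier (mpoly_ring F n).
     \<forall>a\<in>Poly_Mapping.keys p. e dvd weight q n a \<and> k \<le> total_degree n a}"

definition deg_filt :: "'f::comm_ring_1 itself \<Rightarrow> nat \<Rightarrow> nat \<Rightarrow> nat \<Rightarrow> nat \<Rightarrow> 'f mpol set set" where
  "deg_filt F q n e k = trunc_class F q n ` deg_polys F q n e k"

context
  fixes F :: "'f::comm_ring_1 itself" and q n e :: nat
begin

interpretation h: ring_hom_cring "mpoly_ring F n" "trunc_ring F q n" "trunc_class F q n"
  by (rule trunc_class_ring_hom_cring)

lemma deg_polys_add: 
  assumes "p \<in> deg_polys F q n e k" "r \<in> deg_polys F q n e k"
  shows "p + r \<in> deg_polys F q n e k"
  using assms h.R.a_closed[of p r] Poly_Mapping.keys_add[of p r] by (auto simp: deg_polys_def)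

lemma deg_polys_uminus: "p \<in> deg_polys F q n e k \<Longrightarrow> - p \<in> deg_polys F q n e k"
  by (simp add: deg_polys_def uminus_mpoly_ring)

lemma deg_polys_mult:
  assumes "p \<in> deg_polys F q n e k" "r \<in> deg_polys F q n e l"
  shows "p * r \<in> deg_polys F q n e (k + l)"
  unfolding deg_polys_def
proof (intro CollectI conjI ballI)
  show "p * r \<in> carrier (mpoly_ring F n)"
    using assms h.R.m_closed[of p r] by (auto simp: deg_polys_def)
  fix a assume "a \<in> Poly_Mapping.keys (p * r)"
  then obtain b c where "b \<in> Poly_Mapping.keys p" "c \<in> Poly_Mapping.keys r" "a = b + c"
    by (rule keys_mult_obtain)
  then show "e dvd weight q n a" "k + l \<le> total_degree n a"
    using assms by (auto simp: deg_polys_def weight_add total_degree_add intro!: add_mono dvd_add)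
qed

lemma deg_filt_closed: "deg_filt F q n e k \<subseteq> carrier (trunc_ring F q n)"
  by (auto simp: deg_filt_def deg_polys_def)

lemma zero_mem_deg_filt: "\<zero>\<^bsub>trunc_ring F q n\<^esub> \<in> deg_filt F q n e k"
  using h.hom_zero by (auto simp: deg_filt_def deg_polys_def carrier_mpoly_ring_iff intro!: image_eqI[of _ _ 0])

lemma deg_filt_add:
  assumes "x \<in> deg_filt F q n e k" "y \<in> deg_filt F q n e k"
  shows "x \<oplus>\<^bsub>trunc_ring F q n\<^esub> y \<in> deg_filt F q n e k"
proof -
  from assms obtain p r where "p \<in> deg_polys F q n e k" "r \<in> deg_polys F q n e k"
    "x = trunc_class F q n p" "y = trunc_class F q n r"
    by (auto simp: deg_filt_def)
  moreover from this have "x \<oplus>\<^bsub>trunc_ring F q n\<^esub> y = trunc_class F q n (p + r)"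
    using h.hom_add[of p r] by (simp add: deg_polys_def)
  ultimately show ?thesis
    using deg_polys_add[of p k r] by (simp add: deg_filt_def)
qed

lemma deg_filt_mult:
  assumes "x \<in> deg_filt F q n e k" "y \<in> deg_filt F q n e l"
  shows "x \<otimes>\<^bsub>trunc_ring F q n\<^esub> y \<in> deg_filt F q n e (k + l)"
proof -
  from assms obtain p r where "p \<in> deg_polys F q n e k" "r \<in> deg_polys F q n e l"
    "x = trunc_class F q n p" "y = trunc_class F q n r"
    by (auto simp: deg_filt_def)
  moreover from this have "x \<otimes>\<^bsub>trunc_ring F q n\<^esub> y = trunc_class F q n (p * r)"
    using h.hom_mult[of p r] by (simp add: deg_polys_def)
  ultimately show ?thesis
    using deg_polys_mult[of p k r l] by (simp add: deg_filt_def)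
qed

lemma trunc_class_uminus:
  assumes "p \<in> carrier (mpoly_ring F n)"
  shows "\<ominus>\<^bsub>trunc_ring F q n\<^esub> trunc_class F q n p = trunc_class F q n (- p)"
  using h.hom_a_inv[OF assms] by (simp add: uminus_mpoly_ring assms)

lemma deg_filt_a_inv:
  assumes "x \<in> deg_filt F q n e k"
  shows "\<ominus>\<^bsub>trunc_ring F q n\<^esub> x \<in> deg_filt F q n e k"
proof -
  from assms obtain p where p: "p \<in> deg_polys F q n e k" "x = trunc_class F q n p"
    by (auto simp: deg_filt_def)
  then have "\<ominus>\<^bsub>trunc_ring F q n\<^esub> x = trunc_class F q n (- p)"
    by (simp add: trunc_class_uminus deg_polys_def)
  with p show ?thesis
    using deg_polys_uminus by (auto simp: deg_filt_def)
qed

lemma mconst_mem_deg_filt: "trunc_class F q n (mconst c) \<in> deg_filt F q n e 0"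
  unfolding deg_filt_def
  by (rule imageI) (auto simp: deg_polys_def mconst_in_carrier, simp add: mconst_def split: if_splits)

lemma trunc_monom_mem_deg_filt:
  assumes "[(\<Sum>j = 1..n. q ^ (j - 1) * i j) = 0] (mod e)" "k \<le> (\<Sum>j = 1..n. i j)"
  shows "trunc_monom F q n i \<in> deg_filt F q n e k"
proof -
  have "weight q n (expvec n i) = (\<Sum>j = 1..n. q ^ (j - 1) * i j)" "total_degree n (expvec n i) = (\<Sum>j = 1..n. i j)"
    by (auto simp: weight_def total_degree_def lookup_expvec intro!: sum.cong)
  then have "Poly_Mapping.single (expvec n i) 1 \<in> deg_polys F q n e k"
    using assms keys_expvec[of n i] by (auto simp: deg_polys_def carrier_mpoly_ring_iff cong_0_iff)
  then show ?thesis
    by (simp add: trunc_monom_eq deg_filt_def)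
qed

text \<open>Pigeonhole: if the degree exceeds n (q - 1), some exponent reaches q and the term lies
  in the ideal.\<close>

lemma deg_filt_trivial:
  assumes "n * (q - 1) < k"
  shows "deg_filt F q n e k \<subseteq> {\<zero>\<^bsub>trunc_ring F q n\<^esub>}"
proof
  fix x assume "x \<in> deg_filt F q n e k"
  then obtain p where p: "p \<in> deg_polys F q n e k" "x = trunc_class F q n p"
    by (auto simp: deg_filt_def)
  have "\<exists>j\<in>{1..n}. q \<le> Poly_Mapping.lookup a j" if "a \<in> Poly_Mapping.keys p" for a
  proof (rule ccontr)
    assume "\<not> ?thesis"
    then have "Poly_Mapping.lookup a j \<le> q - 1" if "j \<in> {1..n}" for j using that by force
    then have "total_degree n a \<le> n * (q - 1)"
      unfolding total_degree_def using sum_bounded_above[of "{1..n}" "Poly_Mapping.lookup a" "q - 1"] by simp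
    with that p assms show False by (auto simp: deg_polys_def)
  qed
  with p show "x \<in> {\<zero>\<^bsub>trunc_ring F q n\<^esub>}"
    by (auto simp: trunc_class_eq_zero_iff mem_trunc_ideal_iff deg_polys_def)
qed

end

section \<open>The algebra A and its radical\<close>

lemma A_alg_sel [simp]:
  "mult (A_alg F q n e) = mult (trunc_ring F q n)" "one (A_alg F q n e) = one (trunc_ring F q n)"
  "zero (A_alg F q n e) = zero (trunc_ring F q n)" "add (A_alg F q n e) = add (trunc_ring F q n)"
  by (simp_all add: A_alg_def)

lemma carrier_A_alg_subset: "carrier (A_alg F q n e) \<subseteq> deg_filt F q n e 0"
proof
  fix x assume "x \<in> carrier (A_alg F q n e)"
  then have "x \<in> generate_ring (trunc_ring F q n)
        ({trunc_class F q n (mconst c) | c. True} \<union>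
         {trunc_monom F q n i | i. [(\<Sum>j = 1..n. q ^ (j - 1) * i j) = 0] (mod e)})"
    by (simp add: A_alg_def)
  then show "x \<in> deg_filt F q n e 0"
  proof (induction rule: generate_ring.induct)
    case one
    interpret h: ring_hom_cring "mpoly_ring F n" "trunc_ring F q n" "trunc_class F q n"
      by (rule trunc_class_ring_hom_cring)
    show ?case using mconst_mem_deg_filt[of F q n 1 e] h.hom_one by (simp add: mconst_def)
  next
    case (eng_mult x y)
    then show ?case using deg_filt_mult[of x F q n e 0 y 0] by simp
  qed (auto intro: mconst_mem_deg_filt trunc_monom_mem_deg_filt deg_filt_a_inv deg_filt_add)
qed

lemma trunc_monom_mem_A_alg:
  "[(\<Sum>j = 1..n. q ^ (j - 1) * i j) = 0] (mod e) \<Longrightarrow> trunc_monom F q n i \<in> carrier (A_alg F q n e)"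
  by (auto simp: A_alg_def intro: generate_ring.incl)

lemma mconst_mem_A_alg: "trunc_class F q n (mconst c) \<in> carrier (A_alg F q n e)"
  by (auto simp: A_alg_def intro: generate_ring.incl)

lemma trunc_monom_add:
  "trunc_monom F q n (\<lambda>j. i j + k j) = trunc_monom F q n i \<otimes>\<^bsub>trunc_ring F q n\<^esub> trunc_monom F q n k"
proof -
  interpret h: ring_hom_cring "mpoly_ring F n" "trunc_ring F q n" "trunc_class F q n"
    by (rule trunc_class_ring_hom_cring)
  have *: "Poly_Mapping.single (expvec n i) 1 \<in> carrier (mpoly_ring F n)" for i
    using keys_expvec[of n i] by (simp add: carrier_mpoly_ring_iff)
  have "expvec n (\<lambda>j. i j + k j) = expvec n i + expvec n k"
    by (simp add: expvec_def Poly_Mapping.single_add sum.distrib)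
  with h.hom_mult[OF * *, of i k] show ?thesis
    by (simp add: trunc_monom_eq Poly_Mapping.mult_single)
qed

lemma trunc_monom_neq_zero:
  assumes "\<And>j. j \<in> {1..n} \<Longrightarrow> i j < q"
  shows "trunc_monom (F :: 'f::field itself) q n i \<noteq> \<zero>\<^bsub>trunc_ring F q n\<^esub>"
proof -
  have "Poly_Mapping.single (expvec n i) (1::'f) \<in> carrier (mpoly_ring F n)"
    using keys_expvec[of n i] by (simp add: carrier_mpoly_ring_iff)
  moreover have "Poly_Mapping.single (expvec n i) (1::'f) \<notin> trunc_ideal F q n"
    using assms by (force simp: mem_trunc_ideal_iff lookup_expvec)
  ultimately show ?thesis
    by (simp add: trunc_monom_eq trunc_class_eq_zero_iff)
qed

text \<open>The elements of A represented without constant term; this is going to be the Jacobson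
  radical.\<close>

definition aug_ideal :: "'f::field itself \<Rightarrow> nat \<Rightarrow> nat \<Rightarrow> nat \<Rightarrow> 'f mpol set set" where
  "aug_ideal F q n e = carrier (A_alg F q n e) \<inter> deg_filt F q n e 1"

context
  fixes F :: "'f::field itself" and q n e :: nat
  assumes q: "q > 0"
begin

interpretation A: cring "A_alg F q n e" by (rule cring_A_alg)
interpretation h: ring_hom_cring "mpoly_ring F n" "trunc_ring F q n" "trunc_class F q n"
  by (rule trunc_class_ring_hom_cring)

lemma A_alg_closed: "x \<in> carrier (A_alg F q n e) \<Longrightarrow> x \<in> carrier (trunc_ring F q n)"
  using carrier_A_alg_subset deg_filt_closed by blast

text \<open>The two negatives refer to different carriers; they agree because additive inverses in
  the larger ring are unique.\<close>

lemma a_inv_A_alg: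
  assumes "x \<in> carrier (A_alg F q n e)"
  shows "\<ominus>\<^bsub>A_alg F q n e\<^esub> x = \<ominus>\<^bsub>trunc_ring F q n\<^esub> x"
proof -
  have "\<ominus>\<^bsub>A_alg F q n e\<^esub> x \<oplus>\<^bsub>trunc_ring F q n\<^esub> x = \<zero>\<^bsub>trunc_ring F q n\<^esub>"
    using A.l_neg[OF assms] by simp
  with h.S.minus_equality[OF this] show ?thesis
    using assms A.a_inv_closed A_alg_closed by simp
qed

lemma one_neq_zero_trunc_ring: "\<one>\<^bsub>trunc_ring F q n\<^esub> \<noteq> \<zero>\<^bsub>trunc_ring F q n\<^esub>"
proof -
  have "trunc_monom F q n (\<lambda>_. 0) \<noteq> \<zero>\<^bsub>trunc_ring F q n\<^esub>"
    using q by (intro trunc_monom_neq_zero) simp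
  then show ?thesis
    using h.hom_one by (simp add: trunc_monom_eq expvec_def)
qed

lemma ideal_aug_ideal: "ideal (aug_ideal F q n e) (A_alg F q n e)"
proof (rule idealI)
  show "subgroup (aug_ideal F q n e) (add_monoid (A_alg F q n e))"
  proof (rule A.add.subgroupI)
    have "\<zero>\<^bsub>trunc_ring F q n\<^esub> \<in> aug_ideal F q n e"
      using A.zero_closed zero_mem_deg_filt by (simp add: aug_ideal_def)
    then show "aug_ideal F q n e \<noteq> {}" by blast
  next
    fix x assume "x \<in> aug_ideal F q n e"
    then show "\<ominus>\<^bsub>A_alg F q n e\<^esub> x \<in> aug_ideal F q n e"
      using A.a_inv_closed[of x] deg_filt_a_inv[of x F q n e 1] by (simp add: aug_ideal_def a_inv_A_alg)
  next
    fix x y assume "x \<in> aug_ideal F q n e" "y \<in> aug_ideal F q n e"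
    then show "x \<oplus>\<^bsub>A_alg F q n e\<^esub> y \<in> aug_ideal F q n e"
      using A.a_closed[of x y] deg_filt_add[of x F q n e 1 y] by (simp add: aug_ideal_def)
  qed (simp add: aug_ideal_def)
next
  fix x y assume *: "x \<in> aug_ideal F q n e" "y \<in> carrier (A_alg F q n e)"
  then have "y \<in> deg_filt F q n e 0" using carrier_A_alg_subset by blast
  with * show "y \<otimes>\<^bsub>A_alg F q n e\<^esub> x \<in> aug_ideal F q n e"
    using A.m_closed[of y x] deg_filt_mult[of y F q n e 0 x 1] by (simp add: aug_ideal_def)
  with * show "x \<otimes>\<^bsub>A_alg F q n e\<^esub> y \<in> aug_ideal F q n e"
    using A.m_comm[of x y] by (simp add: aug_ideal_def)
qed (rule A.ring_axioms)

lemma nat_pow_mem_deg_filt: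
  assumes "x \<in> aug_ideal F q n e"
  shows "x [^]\<^bsub>A_alg F q n e\<^esub> (k::nat) \<in> deg_filt F q n e k"
proof (induction k)
  case 0
  then show ?case using A.one_closed carrier_A_alg_subset[of F q n e] by auto
next
  case (Suc k)
  then show ?case
    using deg_filt_mult[of _ F q n e k x 1] assms by (simp add: aug_ideal_def)
qed

lemma aug_ideal_nilpotent:
  assumes "x \<in> aug_ideal F q n e"
  shows "x [^]\<^bsub>A_alg F q n e\<^esub> Suc (n * (q - 1)) = \<zero>\<^bsub>A_alg F q n e\<^esub>"
  using nat_pow_mem_deg_filt[OF assms, of "Suc (n * (q - 1))"] deg_filt_trivial[of n q "Suc (n * (q - 1))" F e]
  by (simp del: nat_pow_Suc) blast

lemma one_not_mem_aug_ideal: "\<one>\<^bsub>A_alg F q n e\<^esub> \<notin> aug_ideal F q n e"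
proof
  assume "\<one>\<^bsub>A_alg F q n e\<^esub> \<in> aug_ideal F q n e"
  from aug_ideal_nilpotent[OF this] have "\<one>\<^bsub>A_alg F q n e\<^esub> = \<zero>\<^bsub>A_alg F q n e\<^esub>"
    by (simp only: A.nat_pow_one)
  with one_neq_zero_trunc_ring show False by simp
qed

lemma A_alg_cases:
  assumes x: "x \<in> carrier (A_alg F q n e)"
  obtains c y where "y \<in> aug_ideal F q n e" "x = trunc_class F q n (mconst c) \<oplus>\<^bsub>A_alg F q n e\<^esub> y"
proof -
  obtain p where p: "p \<in> deg_polys F q n e 0" "x = trunc_class F q n p"
    using subsetD[OF carrier_A_alg_subset x] by (auto simp: deg_filt_def)
  define c where "c = Poly_Mapping.lookup p 0"
  define r where "r = p - mconst c"
  have keys: "a \<in> Poly_Mapping.keys p \<and> a \<noteq> 0" if "a \<in> Poly_Mapping.keys r" for a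
    using that by (auto simp: r_def c_def mconst_def Poly_Mapping.in_keys_iff Poly_Mapping.lookup_minus
        Poly_Mapping.lookup_single when_def split: if_splits)
  have r: "r \<in> deg_polys F q n e 1"
    unfolding deg_polys_def
  proof (intro CollectI conjI ballI)
    show "r \<in> carrier (mpoly_ring F n)"
      using keys p(1) by (auto simp: deg_polys_def carrier_mpoly_ring_iff)
    fix a assume a: "a \<in> Poly_Mapping.keys r"
    with keys p(1) show "e dvd weight q n a" by (auto simp: deg_polys_def)
    from keys[OF a] obtain j where j: "j \<in> Poly_Mapping.keys a" by (metis all_not_in_conv keys_eq_empty)
    moreover have "Poly_Mapping.keys a \<subseteq> {1..n}"
      using keys[OF a] p(1) by (auto simp: deg_polys_def carrier_mpoly_ring_iff)
    ultimately have "Poly_Mapping.lookup a j \<le> total_degree n a"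
      unfolding total_degree_def by (intro member_le_sum) auto
    moreover have "Poly_Mapping.lookup a j > 0" using j by (simp add: Poly_Mapping.in_keys_iff)
    ultimately show "1 \<le> total_degree n a" by simp
  qed
  have c: "trunc_class F q n (mconst c) \<in> carrier (A_alg F q n e)" by (rule mconst_mem_A_alg)
  have x_eq: "x = trunc_class F q n (mconst c) \<oplus>\<^bsub>A_alg F q n e\<^esub> trunc_class F q n r"
    using h.hom_add[of "mconst c" r] r p(2) mconst_in_carrier[of c F n] by (simp add: r_def deg_polys_def)
  have "trunc_class F q n r \<in> carrier (trunc_ring F q n)" using r by (simp add: deg_polys_def)
  \<comment> \<open>That the part without constant term lies in A is seen from its being a
    difference of two elements of A, not from its terms.\<close>
  then have "trunc_class F q n r = x \<ominus>\<^bsub>A_alg F q n e\<^esub> trunc_class F q n (mconst c)"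
    using x_eq A_alg_closed[OF c] h.S.a_closed h.S.a_inv_closed
    by (simp add: a_minus_def a_inv_A_alg[OF c] h.S.a_ac h.S.r_neg h.S.r_neg1 h.S.r_neg2)
  also have "\<dots> \<in> carrier (A_alg F q n e)" using x c by (rule A.minus_closed)
  finally have "trunc_class F q n r \<in> aug_ideal F q n e"
    using r by (simp add: aug_ideal_def deg_filt_def)
  with x_eq that show thesis by blast
qed

text \<open>An element outside the ideal has a nonzero constant part c. A larger ideal therefore
  contains c, which is invertible as scalars form a field, and so is everything.\<close>

lemma maximalideal_aug_ideal: "maximalideal (aug_ideal F q n e) (A_alg F q n e)"
proof (rule maximalidealI[OF ideal_aug_ideal])
  show "carrier (A_alg F q n e) \<noteq> aug_ideal F q n e"
    using one_not_mem_aug_ideal A.one_closed by blast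
  fix J assume J: "ideal J (A_alg F q n e)" "aug_ideal F q n e \<subseteq> J"
  interpret J: ideal J "A_alg F q n e" by fact
  show "J = aug_ideal F q n e \<or> J = carrier (A_alg F q n e)"
  proof (cases "J \<subseteq> aug_ideal F q n e")
    case False
    then obtain x where x: "x \<in> J" "x \<notin> aug_ideal F q n e" by blast
    from J.Icarr[OF x(1)] obtain c y where
      y: "y \<in> aug_ideal F q n e" "x = trunc_class F q n (mconst c) \<oplus>\<^bsub>A_alg F q n e\<^esub> y"
      by (rule A_alg_cases)
    let ?c = "trunc_class F q n (mconst c)" and ?d = "trunc_class F q n (mconst (inverse c))"
    have c: "?c \<in> carrier (A_alg F q n e)" "?d \<in> carrier (A_alg F q n e)" by (rule mconst_mem_A_alg)+
    have "c \<noteq> 0"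
    proof
      assume "c = 0"
      then have "?c = \<zero>\<^bsub>A_alg F q n e\<^esub>" using h.hom_zero by (simp add: mconst_def)
      with y x(2) show False using A.l_zero[of y] by (simp add: aug_ideal_def)
    qed
    have "y \<in> J" using y(1) J(2) by blast
    then have "x \<ominus>\<^bsub>A_alg F q n e\<^esub> y \<in> J"
      using x(1) J.a_closed J.a_inv_closed by (simp add: a_minus_def)
    also have "x \<ominus>\<^bsub>A_alg F q n e\<^esub> y = ?c"
      unfolding y(2) using c(1) J.Icarr[OF \<open>y \<in> J\<close>] A.a_assoc[of ?c y "\<ominus>\<^bsub>A_alg F q n e\<^esub> y"] A.r_neg[of y]
      by (simp add: a_minus_def del: A_alg_sel)
    finally have "?c \<otimes>\<^bsub>A_alg F q n e\<^esub> ?d \<in> J" using c(2) by (rule J.I_r_closed)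
    also have "?c \<otimes>\<^bsub>A_alg F q n e\<^esub> ?d = \<one>\<^bsub>A_alg F q n e\<^esub>"
      using h.hom_mult[of "mconst c" "mconst (inverse c)"] h.hom_one \<open>c \<noteq> 0\<close>
      by (simp add: mconst_in_carrier) (simp add: mconst_def Poly_Mapping.mult_single)
    finally have "J = carrier (A_alg F q n e)" by (rule J.one_imp_carrier)
    then show ?thesis ..
  qed (use J in blast)
qed

text \<open>One inclusion is maximality of the augmentation ideal. For the other, its elements are
  nilpotent and hence lie in every prime ideal, in particular in every maximal one.\<close>

lemma jacobson_radical_A_alg: "jacobson_radical (A_alg F q n e) = aug_ideal F q n e"
proof (intro equalityI subsetI)
  fix x assume "x \<in> jacobson_radical (A_alg F q n e)"
  then show "x \<in> aug_ideal F q n e"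
    using maximalideal_aug_ideal by (simp add: jacobson_radical_def)
next
  fix x assume x: "x \<in> aug_ideal F q n e"
  then have x': "x \<in> carrier (A_alg F q n e)" by (simp add: aug_ideal_def)
  have "x \<in> M" if M: "maximalideal M (A_alg F q n e)" for M
  proof -
    interpret M: primeideal M "A_alg F q n e" using M by (rule A.maximalideal_prime)
    have "x [^]\<^bsub>A_alg F q n e\<^esub> k \<in> M \<Longrightarrow> x \<in> M" for k :: nat
    proof (induction k)
      case 0
      then have "M = carrier (A_alg F q n e)" by (intro M.one_imp_carrier) simp
      with M.I_notcarr show ?case by simp
    next
      case (Suc k)
      then show ?case using M.I_prime[of "x [^]\<^bsub>A_alg F q n e\<^esub> k" x] x' by auto
    qed
    from this[of "Suc (n * (q - 1))"] show ?thesis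
      using aug_ideal_nilpotent[OF x] M.additive_subgroup_axioms additive_subgroup.zero_closed by metis
  qed
  with x' show "x \<in> jacobson_radical (A_alg F q n e)" by (simp add: jacobson_radical_def)
qed

lemma nat_pow_ideals_set:
  "I [^]\<^bsub>ideals_set R\<^esub> (0::nat) = carrier R"
  "I [^]\<^bsub>ideals_set R\<^esub> Suc k = ideal_prod R (I [^]\<^bsub>ideals_set R\<^esub> k) I"
  by (simp_all add: nat_pow_def ideals_set_def)

text \<open>Starting degrees add under products, and sums do not lower them.\<close>

lemma radical_power_subset:
  assumes "aug_ideal F q n e \<subseteq> deg_filt F q n e m"
  shows "aug_ideal F q n e [^]\<^bsub>ideals_set (A_alg F q n e)\<^esub> t \<subseteq> deg_filt F q n e (t * m)"
proof (induction t)
  case 0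
  show ?case unfolding nat_pow_ideals_set using carrier_A_alg_subset by simp
next
  case (Suc t)
  have "x \<in> deg_filt F q n e (Suc t * m)"
    if "x \<in> ideal_prod (A_alg F q n e) (aug_ideal F q n e [^]\<^bsub>ideals_set (A_alg F q n e)\<^esub> t) (aug_ideal F q n e)" for x
    using that
  proof (induction rule: ideal_prod.induct)
    case (prod i j)
    then have "i \<in> deg_filt F q n e (t * m)" "j \<in> deg_filt F q n e m"
      using Suc.IH assms by blast+
    from deg_filt_mult[OF this] show ?case by (simp add: add.commute)
  next
    case (sum s1 s2)
    then show ?case using deg_filt_add[of s1 F q n e "Suc t * m" s2] by simp
  qed
  then show ?case unfolding nat_pow_ideals_set by blast
qed

lemma zero_mem_radical_power:
  "\<zero>\<^bsub>trunc_ring F q n\<^esub> \<in> aug_ideal F q n e [^]\<^bsub>ideals_set (A_alg F q n e)\<^esub> (t::nat)"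
proof (induction t)
  case 0
  show ?case unfolding nat_pow_ideals_set using A.zero_closed by simp
next
  case (Suc t)
  have "\<zero>\<^bsub>trunc_ring F q n\<^esub> \<in> aug_ideal F q n e"
    using A.zero_closed zero_mem_deg_filt by (simp add: aug_ideal_def)
  from ideal_prod.prod[OF Suc this, of "A_alg F q n e"] show ?case
    unfolding nat_pow_ideals_set using A.l_null[OF A.zero_closed] by simp
qed

lemma trunc_monom_mem_radical_power:
  fixes l :: nat
  assumes "\<And>k. k < l \<Longrightarrow> e dvd (\<Sum>j = 1..n. q ^ (j - 1) * v k j)" "\<And>k. k < l \<Longrightarrow> \<exists>j\<in>{1..n}. v k j > 0"
  shows "trunc_monom F q n (\<lambda>j. \<Sum>k<l. v k j) \<in> aug_ideal F q n e [^]\<^bsub>ideals_set (A_alg F q n e)\<^esub> l"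
  using assms
proof (induction l)
  case 0
  have "trunc_monom F q n (\<lambda>j. 0) \<in> carrier (A_alg F q n e)"
    by (rule trunc_monom_mem_A_alg) simp
  then show ?case unfolding nat_pow_ideals_set by simp
next
  case (Suc l)
  have w: "[(\<Sum>j = 1..n. q ^ (j - 1) * v l j) = 0] (mod e)"
    using Suc.prems(1)[of l] by (simp add: cong_0_iff)
  obtain j where j: "j \<in> {1..n}" "v l j > 0" using Suc.prems(2)[of l] by blast
  then have "v l j \<le> (\<Sum>j = 1..n. v l j)" by (intro member_le_sum) auto
  with j have "trunc_monom F q n (v l) \<in> deg_filt F q n e 1"
    using w by (intro trunc_monom_mem_deg_filt) auto
  with trunc_monom_mem_A_alg[OF w] have "trunc_monom F q n (v l) \<in> aug_ideal F q n e"
    by (simp add: aug_ideal_def)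
  moreover have "trunc_monom F q n (\<lambda>j. \<Sum>k<l. v k j) \<in> aug_ideal F q n e [^]\<^bsub>ideals_set (A_alg F q n e)\<^esub> l"
    using Suc by simp
  ultimately show ?case
    using ideal_prod.prod[of _ _ _ _ "A_alg F q n e"] unfolding nat_pow_ideals_set by (simp add: trunc_monom_add)
qed

lemma aug_ideal_subset_deg_filt:
  assumes "\<And>a. a \<noteq> 0 \<Longrightarrow> Poly_Mapping.keys a \<subseteq> {1..n} \<Longrightarrow> e dvd weight q n a \<Longrightarrow> m \<le> total_degree n a"
  shows "aug_ideal F q n e \<subseteq> deg_filt F q n e m"
proof
  fix x assume "x \<in> aug_ideal F q n e"
  then obtain p where p: "p \<in> deg_polys F q n e 1" "x = trunc_class F q n p"
    by (auto simp: aug_ideal_def deg_filt_def)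
  have "m \<le> total_degree n a" if "a \<in> Poly_Mapping.keys p" for a
  proof (rule assms)
    show "a \<noteq> 0" using p(1) that by (auto simp: deg_polys_def total_degree_def)
  qed (use p(1) that in \<open>auto simp: deg_polys_def carrier_mpoly_ring_iff\<close>)
  then have "p \<in> deg_polys F q n e m" using p(1) by (simp add: deg_polys_def)
  with p(2) show "x \<in> deg_filt F q n e m" by (simp add: deg_filt_def)
qed

text \<open>Power R + 1 of the radical starts in degree (R + 1) m, beyond the largest surviving
  degree n (q - 1), and so vanishes; the vectors \<open>v\<close> show that no earlier power
  does.\<close>

lemma loewy_length_A_alg:
  assumes "\<And>a. a \<noteq> 0 \<Longrightarrow> Poly_Mapping.keys a \<subseteq> {1..n} \<Longrightarrow> e dvd weight q n a \<Longrightarrow> m \<le> total_degree n a"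
    and "n * (q - 1) < Suc R * m"
    and v: "\<And>k. k < (R::nat) \<Longrightarrow> e dvd (\<Sum>j = 1..n. q ^ (j - 1) * v k j)" "\<And>k. k < R \<Longrightarrow> \<exists>j\<in>{1..n}. v k j > 0"
    "\<And>j. j \<in> {1..n} \<Longrightarrow> (\<Sum>k<R. v k j) \<le> q - 1"
  shows "loewy_length (A_alg F q n e) = Suc R"
  unfolding loewy_length_def jacobson_radical_A_alg
proof (rule Least_equality)
  have "aug_ideal F q n e [^]\<^bsub>ideals_set (A_alg F q n e)\<^esub> Suc R \<subseteq> {\<zero>\<^bsub>trunc_ring F q n\<^esub>}"
    using radical_power_subset[OF aug_ideal_subset_deg_filt[OF assms(1)], of "Suc R"]
      deg_filt_trivial[OF assms(2), of F e] by blast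
  then show "aug_ideal F q n e [^]\<^bsub>ideals_set (A_alg F q n e)\<^esub> Suc R = {\<zero>\<^bsub>A_alg F q n e\<^esub>}"
    using zero_mem_radical_power[of "Suc R"] by (simp del: nat_pow_Suc) blast
next
  fix l :: nat assume l: "aug_ideal F q n e [^]\<^bsub>ideals_set (A_alg F q n e)\<^esub> l = {\<zero>\<^bsub>A_alg F q n e\<^esub>}"
  show "Suc R \<le> l"
  proof (rule ccontr)
    assume "\<not> Suc R \<le> l"
    then have "l \<le> R" by simp
    \<comment> \<open>For smaller l the first l vectors serve: leaving out the rest only lowers the
      exponents.\<close>
    then have "trunc_monom F q n (\<lambda>j. \<Sum>k<l. v k j) = \<zero>\<^bsub>trunc_ring F q n\<^esub>"
      using trunc_monom_mem_radical_power[of l v] v(1,2) l by simp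
    moreover have "(\<Sum>k<l. v k j) < q" if "j \<in> {1..n}" for j
    proof -
      have "(\<Sum>k<l. v k j) \<le> (\<Sum>k<R. v k j)" using \<open>l \<le> R\<close> by (intro sum_mono2) auto
      with v(3)[OF that] q show ?thesis by linarith
    qed
    then have "trunc_monom F q n (\<lambda>j. \<Sum>k<l. v k j) \<noteq> \<zero>\<^bsub>trunc_ring F q n\<^esub>"
      by (rule trunc_monom_neq_zero)
    ultimately show False by contradiction
  qed
qed

end

section \<open>The Loewy length\<close>

text \<open>Listing each weight q^(j-1) as often as the exponent of the j-th variable gives a zero
  sum whose length is the total degree.\<close>

lemma total_degree_ge_m_number:
  assumes "e > 0" "a \<noteq> 0" "Poly_Mapping.keys a \<subseteq> {1..n}" "e dvd weight q n a"
  shows "m_number q e \<le> total_degree n a"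
proof (rule m_number_props(3)[OF assms(1)])
  obtain j where j: "j \<in> Poly_Mapping.keys a" using assms(2) by (metis all_not_in_conv keys_eq_empty)
  then have "Poly_Mapping.lookup a j \<le> total_degree n a"
    unfolding total_degree_def using assms(3) by (intro member_le_sum) auto
  with j show "total_degree n a > 0" by (simp add: Poly_Mapping.in_keys_iff)
  define xs where "xs = concat (map (\<lambda>j. replicate (Poly_Mapping.lookup a j) (q ^ (j - 1) mod e)) [1..<Suc n])"
  have sum_upt: "sum_list (map f [1..<Suc n]) = (\<Sum>j = 1..n. f j)" for f :: "nat \<Rightarrow> nat"
    by (simp only: interv_sum_list_conv_sum_set_nat set_upt atLeastLessThanSuc_atLeastAtMost)
  have len: "length xs = total_degree n a"
    by (simp only: xs_def length_concat map_map comp_def length_replicate sum_upt total_degree_def)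
  have sum_concat: "sum_list (concat xss) = sum_list (map sum_list xss)" for xss :: "nat list list"
    by (induction xss) simp_all
  have "sum_list xs = (\<Sum>j = 1..n. Poly_Mapping.lookup a j * (q ^ (j - 1) mod e))"
    by (simp only: xs_def sum_concat map_map comp_def sum_list_replicate sum_upt of_nat_id)
  also have "\<dots> mod e = weight q n a mod e"
    unfolding weight_def by (subst (1 2) mod_sum_eq[symmetric]) (simp add: mod_simps mult.commute)
  finally have "e dvd sum_list xs" using assms(4) by (simp add: dvd_eq_mod_eq_0)
  moreover have "set xs \<subseteq> power_residues e q" by (auto simp: xs_def power_residues_def)
  ultimately show "zero_sum e q (total_degree n a)"
    unfolding zero_sum_def
    by (intro exI[of _ "(!) xs"]) (auto simp: len sum_list_sum_nth atLeast0LessThan dest: nth_mem)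
qed

lemma packs_remainder:
  assumes "coprime e q" "e > 0" "e \<le> 32" "b < m_number q e" "gcd e (q - 1) dvd b"
  shows "packs e (repeat_mset b (mset_set (power_residues e q))) (b * ord e q div m_number q e)"
proof (cases "e = 1")
  case True
  with assms(4) m_number_props(4)[of e q] have "b = 0" by simp
  then show ?thesis by simp
next
  case False
  define g where "g = q mod e"
  have e: "e > 1" using False assms(2) by simp
  have cop: "coprime e g" using assms(1) e by (simp add: g_def coprime_commute)
  have "g > 0" using cop e by (cases "g = 0") auto
  \<comment> \<open>Both g + e - 1 and q - 1 differ from g - 1 by a multiple of e, so the gcd with e
    is the same.\<close>
  then have "g + e - 1 = (g - 1) + e" "q - 1 = (q div e) * e + (g - 1)"
    using div_mult_mod_eq[of q e] by (simp_all add: g_def)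
  then have c: "gcd e (g + e - 1) = gcd e (q - 1)"
    by (metis gcd_add_mult add.commute gcd_add2)
  have "g < e" using e by (simp add: g_def)
  have e': "e \<in> set [2..<33]" unfolding set_upt atLeastLessThan_iff using e assms(3) by linarith
  have g: "g \<in> set (filter (\<lambda>g. gcd e g = 1) [0..<e])"
    using cop \<open>g < e\<close> by (simp add: coprime_iff_gcd_eq_1)
  have "packing_check e g"
    by (rule bspec[OF bspec[OF packing_check_table[unfolded list_all_iff] e'] g])
  from packing_check_sound[OF this cop e, of b] assms(4,5) c show ?thesis
    by (simp add: g_def m_number_mod)
qed

theorem proposition6p1:
  fixes F :: "'f::field itself" and q n e :: nat
  assumes "q > 1" and "n \<ge> 1" and "e \<ge> 1" and "e dvd q ^ n - 1" and "e \<le> 32"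
  shows "int (loewy_length (A_alg F q n e)) =
           \<lfloor>real n * ((real q - 1) / real (m_number q e))\<rfloor> + 1"
proof -
  define m where "m = m_number q e"
  define R where "R = n * (q - 1) div m"
  have e: "e > 0" and q: "q > 0" using assms by auto
  have m: "m > 0" unfolding m_def by (rule m_number_props(1)[OF e])
  have "[q ^ n = 1] (mod e)" using assms(1,4) by (simp add: cong_altdef_nat)
  \<comment> \<open>A power of q that is 1 modulo e makes q a unit there, because n is
    positive.\<close>
  then have "coprime e (q ^ n)" by (metis cong_imp_coprime cong_sym coprime_1_right coprime_commute)
  then have cop: "coprime e q" using assms(2) by simp
  obtain v where v:
    "\<And>k. k < R \<Longrightarrow> e dvd (\<Sum>j = 1..n. q ^ (j - 1) * v k j)"
    "\<And>k. k < R \<Longrightarrow> \<exists>j\<in>{1..n}. v k j > 0"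
    "\<And>j. j \<in> {1..n} \<Longrightarrow> (\<Sum>k<R. v k j) \<le> q - 1"
    by (rule exponent_vectors[OF cop e q assms(4) packs_remainder[OF cop e assms(5)],
          folded m_def, folded R_def]) blast+
  have lt: "n * (q - 1) < Suc R * m"
    using dividend_less_times_div[OF m, of "n * (q - 1)"] by (simp add: R_def mult.commute)
  have "loewy_length (A_alg F q n e) = Suc R"
  proof (rule loewy_length_A_alg[OF q, where m = m and v = v])
    fix a :: "nat \<Rightarrow>\<^sub>0 nat"
    assume "a \<noteq> 0" "Poly_Mapping.keys a \<subseteq> {1..n}" "e dvd weight q n a"
    then show "m \<le> total_degree n a" unfolding m_def by (rule total_degree_ge_m_number[OF e])
  qed (fact lt, (rule v, assumption)+)
  moreover have "\<lfloor>real n * ((real q - 1) / real m)\<rfloor> = int R"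
  proof -
    have "real n * ((real q - 1) / real m) = real (n * (q - 1)) / real m"
      using q by (simp add: of_nat_diff)
    then show ?thesis by (simp only: R_def floor_divide_of_nat_eq)
  qed
  ultimately show ?thesis by (simp add: m_def)
qed

end
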